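(* For all $F\in\mathcal{S}$ one has $$F=E[F]+\sum_{k=0}^\infty E[D_kF\mid\mathcal{F}_{k-1}]\,Y_k = E[F]+\sum_{k=0}^\infty Y_k\,D_kE[F\mid\mathcal{F}_k],$$ the series converging in $L^2(\Omega)$.
   Context: $\mathbb{N}=\{0,1,2,\ldots\}$. Let $(p_k)_{k\in\mathbb{N}}$ be a deterministic sequence in $(0,1)$ and $q_k=1-p_k$. Let $\Omega=\{-1,1\}^{\mathbb{N}}$ with its product $\sigma$-algebra, let $X_k:\Omega\to\{-1,1\}$ be the canonical projections, and let $\mathbb{P}$ be the product probability measure under which the $X_k$ are independent with $\mathbb{P}(X_k=1)=p_k$, $\mathbb{P}(X_k=-1)=q_k$. Set $Y_k=\frac{q_k-p_k+X_k}{2\sqrt{p_kq_k}}$, $\mathcal{F}_n=\sigma(X_0,\ldots,X_n)$ for $n\ge0$, $\mathcal{F}_{-1}=\{\emptyset,\Omega\}$. Let $\ell^2(\mathbb{N})^{\circ n}$ be the space of symmetric functions in $\ell^2(\mathbb{N}^n)$, and $\Delta_n=\{(k_1,\ldots,k_n)\in\mathbb{N}^n: k_i\ne k_j,\ 1\le i<j\le n\}$. For $f_n\in\ell^2(\mathbb{N})^{\circ n}$, $n\ge1$, put $J_n(f_n)=\sum_{(i_1,\ldots,i_n)\in\Delta_n}f_n(i_1,\ldots,i_n)Y_{i_1}\cdots Y_{i_n}$ (convergence in $L^2(\Omega)$), and $J_0(f_0)=f_0$ for $f_0\in\mathbb{R}$. $\mathcal{S}$ is the linear space of finite sums $\sum_{k=0}^nJ_k(f_k)$,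 $f_k\in\ell^2(\mathbb{N})^{\circ k}$, $n\in\mathbb{N}$. The gradient $D$ is the linear operator on $\mathcal{S}$ defined by $D_kJ_n(f_n)=nJ_{n-1}(f_n( *,k)\mathbf{1}_{\Delta_n}( *,k))$, $k\in\mathbb{N}$, where $*$ stands for the first $n-1$ variables; equivalently $D_kF(\omega)=\sqrt{p_kq_k}\,(F(\omega_+^k)-F(\omega_-^k))$, where $\omega_\pm^k$ is $\omega$ with its $k$-th coordinate replaced by $\pm1$. *)

theory Defs
  imports "HOL-Probability.Probability"
begin

text \<open>Square-integrable functions and convergence in \<open>L\<^sup>2\<close>. Elements of \<open>L\<^sup>2\<close> are represented by
  measurable functions; equality in \<open>L\<^sup>2\<close> is almost-everywhere equality.\<close>

definition L2_fun :: "'a measure \<Rightarrow> ('a \<Rightarrow> real) set" where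
  "L2_fun M = {f \<in> borel_measurable M. integrable M (\<lambda>x. (f x)\<^sup>2)}"

definition L2_norm :: "'a measure \<Rightarrow> ('a \<Rightarrow> real) \<Rightarrow> real" where
  "L2_norm M f = sqrt (\<integral>x. (f x)\<^sup>2 \<partial>M)"

definition L2_sums :: "'a measure \<Rightarrow> (nat \<Rightarrow> 'a \<Rightarrow> real) \<Rightarrow> ('a \<Rightarrow> real) \<Rightarrow> bool" where
  "L2_sums M g G \<longleftrightarrow> (\<forall>k. g k \<in> L2_fun M) \<and> G \<in> L2_fun M \<and>
     (\<lambda>N. L2_norm M (\<lambda>x. (\<Sum>k<N. g k x) - G x)) \<longlonglongrightarrow> 0"

text \<open>Unordered sums in \<open>L\<^sup>2\<close>, in analogy with \<^const>\<open>has_sum\<close>.\<close>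

definition L2_has_sum :: "'a measure \<Rightarrow> ('i \<Rightarrow> 'a \<Rightarrow> real) \<Rightarrow> 'i set \<Rightarrow> ('a \<Rightarrow> real) \<Rightarrow> bool" where
  "L2_has_sum M g I G \<longleftrightarrow> (\<forall>i\<in>I. g i \<in> L2_fun M) \<and> G \<in> L2_fun M \<and>
     ((\<lambda>T. L2_norm M (\<lambda>x. (\<Sum>i\<in>T. g i x) - G x)) \<longlongrightarrow> 0) (finite_subsets_at_top I)"

text \<open>The space of this measure is the set of all functions from \<open>\<nat>\<close> to \<open>{-1, 1}\<close>.\<close>

definition walk_measure :: "(nat \<Rightarrow> real) \<Rightarrow> (nat \<Rightarrow> real) measure" where
  "walk_measure p = (\<Pi>\<^sub>M k\<in>UNIV. point_measure {-1, 1} (\<lambda>x. ennreal (if x = 1 then p k else 1 - p k)))"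

definition X :: "nat \<Rightarrow> (nat \<Rightarrow> real) \<Rightarrow> real" where
  "X k \<omega> = \<omega> k"

definition Y :: "(nat \<Rightarrow> real) \<Rightarrow> nat \<Rightarrow> (nat \<Rightarrow> real) \<Rightarrow> real" where
  "Y p k \<omega> = ((1 - p k) - p k + X k \<omega>) / (2 * sqrt (p k * (1 - p k)))"

text \<open>The filtration is indexed by integers, so that index \<open>-1\<close> gives the trivial
  \<open>\<sigma>\<close>-algebra (no generators).\<close>

definition Filt :: "(nat \<Rightarrow> real) \<Rightarrow> int \<Rightarrow> (nat \<Rightarrow> real) measure" where
  "Filt p n = sigma (space (walk_measure p))
     {X i -` A \<inter> space (walk_measure p) | i A. int i \<le> n \<and> A \<in> sets borel}"

text \<open>A point of \<open>\<nat>\<^sup>n\<close> is a list of length \<open>n\<close>, so a function on \<open>\<nat>\<^sup>n\<close> is a function on lists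
  whose values at lists of other lengths are irrelevant. For \<open>n = 0\<close> it is the real number
  \<open>f []\<close>.\<close>

definition sym_l2 :: "nat \<Rightarrow> (nat list \<Rightarrow> real) set" where
  "sym_l2 n = {f. (\<lambda>is. (f is)\<^sup>2) summable_on {is. length is = n} \<and>
     (\<forall>is js. length is = n \<and> mset is = mset js \<longrightarrow> f is = f js)}"

definition Delta :: "nat \<Rightarrow> nat list set" where
  "Delta n = {is. length is = n \<and> distinct is}"

text \<open>Multiple stochastic integrals and the gradient are determined only up to almost-everywhere
  equality, hence the choice of a representative.\<close>

definition J :: "(nat \<Rightarrow> real) \<Rightarrow> nat \<Rightarrow> (nat list \<Rightarrow> real) \<Rightarrow> (nat \<Rightarrow> real) \<Rightarrow> real" where
  "J p n f = (if n = 0 then (\<lambda>\<omega>. f [])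
     else (SOME G. L2_has_sum (walk_measure p)
                     (\<lambda>is \<omega>. f is * (\<Prod>i\<leftarrow>is. Y p i \<omega>)) (Delta n) G))"

definition chaos_expansion ::
  "(nat \<Rightarrow> real) \<Rightarrow> nat \<Rightarrow> (nat \<Rightarrow> nat list \<Rightarrow> real) \<Rightarrow> ((nat \<Rightarrow> real) \<Rightarrow> real) \<Rightarrow> bool" where
  "chaos_expansion p n f F \<longleftrightarrow> (\<forall>m\<le>n. f m \<in> sym_l2 m) \<and>
     F \<in> borel_measurable (walk_measure p) \<and>
     (AE \<omega> in walk_measure p. F \<omega> = (\<Sum>m\<le>n. J p m (f m) \<omega>))"

definition chaos_space :: "(nat \<Rightarrow> real) \<Rightarrow> ((nat \<Rightarrow> real) \<Rightarrow> real) set" where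
  "chaos_space p = {F. \<exists>n f. chaos_expansion p n f F}"

text \<open>The gradient is the linear operator on \<^const>\<open>chaos_space\<close> with
  \<open>D\<^sub>k (J\<^sub>m f) = m J\<^bsub>m-1\<^esub> (f(-, k) 1\<^bsub>\<Delta>\<^sub>m\<^esub>(-, k))\<close>. The values of \<open>f m\<close> on \<^term>\<open>Delta m\<close> are determined
  by \<open>F\<close>, so that the result does not depend on the expansion up to almost-everywhere
  equality. The dash stands for the first \<open>m - 1\<close> variables; the summand for \<open>m = 0\<close> vanishes because of the factor \<open>m\<close>.\<close>

definition grad :: "(nat \<Rightarrow> real) \<Rightarrow> nat \<Rightarrow> ((nat \<Rightarrow> real) \<Rightarrow> real) \<Rightarrow> (nat \<Rightarrow> real) \<Rightarrow> real" where
  "grad p k F = (SOME G. \<exists>n f. chaos_expansion p n f F \<and>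
     G = (\<lambda>\<omega>. \<Sum>m\<le>n. real m *
           J p (m - 1) (\<lambda>is. f m (is @ [k]) * indicator (Delta m) (is @ [k])) \<omega>))"

end

theory Submission
  imports Defs
begin

text \<open>The products of the \<open>Y\<^sub>i\<close> over finite index sets \<open>A\<close> are orthonormal, and every function of
  \<open>\<omega> 0, \<dots>, \<omega> (N - 1)\<close> is a linear combination of those with \<open>A \<subseteq> {0, \<dots>, N - 1}\<close>. Hence
  \<open>E[G | F\<^bsub>N-1\<^esub>]\<close> is the finite sum of \<open>c\<^sub>A(G) Y\<^sub>A\<close> over these \<open>A\<close>, where \<open>c\<^sub>A(G) = E[G Y\<^sub>A]\<close>.
  An element of the chaos space is determined by its coefficients and is the limit of these finite sums,
  and the gradient \<open>D\<^sub>k\<close> acts by \<open>c\<^sub>B(D\<^sub>k F) = c\<^bsub>B \<union> {k}\<^esub>(F)\<close> for \<open>k \<notin> B\<close>. So in both series the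
  \<open>k\<close>-th term is the sum of \<open>c\<^sub>A(F) Y\<^sub>A\<close> over the \<open>A\<close> with maximum \<open>k\<close>, and the partial sums are
  \<open>E[F | F\<^bsub>N-1\<^esub>] - E[F]\<close>.\<close>

subsection \<open>Square-integrable functions\<close>

lemma L2_funD:
  assumes "f \<in> L2_fun M"
  shows "f \<in> borel_measurable M" "integrable M (\<lambda>x. (f x)\<^sup>2)"
  using assms by (auto simp: L2_fun_def)

lemma L2_fun_mult_integrable:
  assumes "f \<in> L2_fun M" "g \<in> L2_fun M"
  shows "integrable M (\<lambda>x. f x * g x)"
proof (rule Bochner_Integration.integrable_bound)
  note [measurable] = assms[THEN L2_funD(1)]
  show "integrable M (\<lambda>x. (f x)\<^sup>2 + (g x)\<^sup>2)"
    using assms by (auto simp: L2_fun_def)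
  show "(\<lambda>x. f x * g x) \<in> borel_measurable M" by measurable
  have "\<bar>a * b\<bar> \<le> a\<^sup>2 + b\<^sup>2" for a b :: real
    using sum_squares_bound[of "\<bar>a\<bar>" "\<bar>b\<bar>"] mult_nonneg_nonneg[OF abs_ge_zero abs_ge_zero, of a b]
    by (simp add: abs_mult del: mult_nonneg_nonneg)
  then show "AE x in M. norm (f x * g x) \<le> norm ((f x)\<^sup>2 + (g x)\<^sup>2)"
    by simp
qed

lemma L2_fun_add:
  assumes "f \<in> L2_fun M" "g \<in> L2_fun M"
  shows "(\<lambda>x. f x + g x) \<in> L2_fun M"
  using assms L2_fun_mult_integrable[OF assms]
  by (auto simp: L2_fun_def power2_sum mult.assoc)

lemma L2_fun_cmult:
  assumes "f \<in> L2_fun M"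
  shows "(\<lambda>x. c * f x) \<in> L2_fun M"
  using assms by (auto simp: L2_fun_def power_mult_distrib)

lemma L2_fun_diff:
  assumes "f \<in> L2_fun M" "g \<in> L2_fun M"
  shows "(\<lambda>x. f x - g x) \<in> L2_fun M"
  using L2_fun_add[OF assms(1) L2_fun_cmult[OF assms(2), of "-1"]] by simp

lemma L2_fun_sum:
  assumes "\<And>i. i \<in> I \<Longrightarrow> f i \<in> L2_fun M"
  shows "(\<lambda>x. \<Sum>i\<in>I. f i x) \<in> L2_fun M"
  using assms
proof (induction I rule: infinite_finite_induct)
  case (insert i I)
  then have "(\<lambda>x. f i x + (\<Sum>i\<in>I. f i x)) \<in> L2_fun M"
    by (intro L2_fun_add) auto
  then show ?case
    using insert by simp
qed (auto simp: L2_fun_def)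

lemma L2_fun_cong_AE:
  assumes "f \<in> L2_fun M" "g \<in> borel_measurable M" "AE x in M. g x = f x"
  shows "g \<in> L2_fun M"
proof -
  note [measurable] = L2_funD(1)[OF assms(1)] assms(2)
  have "integrable M (\<lambda>x. (g x)\<^sup>2) \<longleftrightarrow> integrable M (\<lambda>x. (f x)\<^sup>2)"
    using assms(3) by (intro integrable_cong_AE) auto
  then show ?thesis
    using assms by (auto simp: L2_fun_def)
qed

text \<open>Integrate the pointwise bound that follows from
  \<open>2 * a * b \<le> a\<^sup>2 + b\<^sup>2\<close>. It serves as a triangle inequality for
  squared norms; the factor 2 is harmless where only convergence to 0 matters.\<close>

lemma integral_power2_sum_le:
  assumes "f \<in> L2_fun M" "g \<in> L2_fun M"
  shows "(\<integral>x. (f x + g x)\<^sup>2 \<partial>M) \<le> 2 * (\<integral>x. (f x)\<^sup>2 \<partial>M) + 2 * (\<integral>x. (g x)\<^sup>2 \<partial>M)"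
proof -
  have "(\<integral>x. (f x + g x)\<^sup>2 \<partial>M) \<le> (\<integral>x. 2 * (f x)\<^sup>2 + 2 * (g x)\<^sup>2 \<partial>M)"
  proof (rule integral_mono)
    show "integrable M (\<lambda>x. (f x + g x)\<^sup>2)"
      using L2_fun_add[OF assms] by (simp add: L2_fun_def)
    show "integrable M (\<lambda>x. 2 * (f x)\<^sup>2 + 2 * (g x)\<^sup>2)"
      using assms by (auto simp: L2_fun_def)
    show "(f x + g x)\<^sup>2 \<le> 2 * (f x)\<^sup>2 + 2 * (g x)\<^sup>2" for x
      using sum_squares_bound[of "f x" "g x"] by (simp add: power2_sum)
  qed
  also have "\<dots> = 2 * (\<integral>x. (f x)\<^sup>2 \<partial>M) + 2 * (\<integral>x. (g x)\<^sup>2 \<partial>M)"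
    using assms by (simp add: L2_fun_def)
  finally show ?thesis .
qed

lemma integral_power2_triangle:
  assumes "f \<in> L2_fun M" "g \<in> L2_fun M" "h \<in> L2_fun M"
  shows "(\<integral>x. (f x - h x)\<^sup>2 \<partial>M) \<le> 2 * (\<integral>x. (f x - g x)\<^sup>2 \<partial>M) + 2 * (\<integral>x. (g x - h x)\<^sup>2 \<partial>M)"
  using integral_power2_sum_le[OF L2_fun_diff[OF assms(1,2)] L2_fun_diff[OF assms(2,3)]] by simp

context prob_space
begin

lemma L2_fun_integrable:
  assumes "f \<in> L2_fun M"
  shows "integrable M f"
  using assms square_integrable_imp_integrable by (auto simp: L2_fun_def)

text \<open>The variance of \<open>\<bar>f\<bar>\<close> is nonnegative. This turns an L2 Cauchy
  sequence into an L1 Cauchy sequence, to which the subsequence theorem applies.\<close>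

lemma power2_expectation_abs_le:
  fixes f :: "'a \<Rightarrow> real"
  assumes "f \<in> L2_fun M"
  shows "(expectation (\<lambda>x. \<bar>f x\<bar>))\<^sup>2 \<le> expectation (\<lambda>x. (f x)\<^sup>2)"
  using variance_eq[of "\<lambda>x. \<bar>f x\<bar>"] variance_positive[of "\<lambda>x. \<bar>f x\<bar>"]
    L2_fun_integrable[OF assms] L2_funD[OF assms]
  by simp

text \<open>Riesz--Fischer: an almost everywhere convergent subsequence provides the limit, and Fatou's
  lemma the convergence of the whole sequence.\<close>

lemma L2_complete:
  fixes s :: "nat \<Rightarrow> 'a \<Rightarrow> real"
  assumes s: "\<And>n. s n \<in> L2_fun M"
    and Cauchy: "\<And>e. e > 0 \<Longrightarrow> \<exists>N. \<forall>i\<ge>N. \<forall>j\<ge>N. expectation (\<lambda>x. (s i x - s j x)\<^sup>2) < e"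
  obtains G where "G \<in> L2_fun M" "(\<lambda>n. expectation (\<lambda>x. (s n x - G x)\<^sup>2)) \<longlonglongrightarrow> 0"
proof -
  note [measurable] = s[THEN L2_funD(1)]
  have "\<exists>N. \<forall>i\<ge>N. \<forall>j\<ge>N. expectation (\<lambda>x. norm (s i x - s j x)) < e" if "e > 0" for e
  proof -
    have "e\<^sup>2 > 0"
      using that by simp
    from Cauchy[OF this] obtain N where
      N: "\<And>i j. i \<ge> N \<Longrightarrow> j \<ge> N \<Longrightarrow> expectation (\<lambda>x. (s i x - s j x)\<^sup>2) < e\<^sup>2"
      by meson
    have "expectation (\<lambda>x. norm (s i x - s j x)) < e" if "i \<ge> N" "j \<ge> N" for i j
    proof (rule power_less_imp_less_base)
      show "(expectation (\<lambda>x. norm (s i x - s j x)))\<^sup>2 < e\<^sup>2"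
        using power2_expectation_abs_le[OF L2_fun_diff[OF s s], of i j] N[OF that] by simp
    qed (use \<open>e > 0\<close> in simp)
    then show ?thesis by meson
  qed
  from cauchy_L1_AE_cauchy_subseq[OF L2_fun_integrable[OF s] this]
  obtain r where r: "strict_mono r" and AE: "AE x in M. Cauchy (\<lambda>i. s (r i) x)"
    by blast
  \<comment> \<open>On the null set where the subsequence diverges, \<open>lim\<close> takes some
    unspecified value; this total choice is still measurable.\<close>
  define G where "G = (\<lambda>x. lim (\<lambda>i. s (r i) x))"
  have [measurable]: "G \<in> borel_measurable M"
    unfolding G_def by measurable
  have lim: "AE x in M. (\<lambda>i. s (r i) x) \<longlonglongrightarrow> G x"
    using AE by eventually_elim (simp add: G_def Cauchy_convergent_iff convergent_LIMSEQ_iff)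
  have bound: "integrable M (\<lambda>x. (s n x - G x)\<^sup>2) \<and> expectation (\<lambda>x. (s n x - G x)\<^sup>2) \<le> e"
    if N: "\<And>i j. i \<ge> N \<Longrightarrow> j \<ge> N \<Longrightarrow> expectation (\<lambda>x. (s i x - s j x)\<^sup>2) < e" and n: "n \<ge> N" for N n e
  proof -
    have "e > 0"
      using N[of n n] n by simp
    have "(\<integral>\<^sup>+x. ennreal ((s n x - G x)\<^sup>2) \<partial>M)
        = (\<integral>\<^sup>+x. liminf (\<lambda>i. ennreal ((s n x - s (r i) x)\<^sup>2)) \<partial>M)"
    proof (rule nn_integral_cong_AE)
      show "AE x in M. ennreal ((s n x - G x)\<^sup>2) = liminf (\<lambda>i. ennreal ((s n x - s (r i) x)\<^sup>2))"
        using lim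
      proof eventually_elim
        case (elim x)
        have "(\<lambda>i. ennreal ((s n x - s (r i) x)\<^sup>2)) \<longlonglongrightarrow> ennreal ((s n x - G x)\<^sup>2)"
          by (intro tendsto_intros elim)
        then show ?case
          by (intro lim_imp_Liminf[symmetric]) auto
      qed
    qed
    also have "\<dots> \<le> liminf (\<lambda>i. \<integral>\<^sup>+x. ennreal ((s n x - s (r i) x)\<^sup>2) \<partial>M)"
      by (rule nn_integral_liminf) measurable
    also have "\<dots> \<le> ennreal e"
    proof (rule Liminf_le)
      show "\<forall>\<^sub>F i in sequentially. (\<integral>\<^sup>+x. ennreal ((s n x - s (r i) x)\<^sup>2) \<partial>M) \<le> ennreal e"
      proof (rule eventually_sequentiallyI)
        fix i assume "N \<le> i"
        then have "r i \<ge> N"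
          using seq_suble[OF r, of i] by simp
        then show "(\<integral>\<^sup>+x. ennreal ((s n x - s (r i) x)\<^sup>2) \<partial>M) \<le> ennreal e"
          using N[OF n, of "r i"] L2_funD(2)[OF L2_fun_diff[OF s s]]
          by (subst nn_integral_eq_integral) (auto intro!: ennreal_leI)
      qed
    qed simp
    finally have le: "(\<integral>\<^sup>+x. ennreal ((s n x - G x)\<^sup>2) \<partial>M) \<le> ennreal e" .
    have int: "integrable M (\<lambda>x. (s n x - G x)\<^sup>2)"
      using le by (intro integrableI_bounded) (auto simp: le_less_trans)
    with le \<open>e > 0\<close> show ?thesis
      by (simp add: nn_integral_eq_integral)
  qed
  obtain N1 where "\<And>i j. i \<ge> N1 \<Longrightarrow> j \<ge> N1 \<Longrightarrow> expectation (\<lambda>x. (s i x - s j x)\<^sup>2) < 1"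
    using Cauchy[OF zero_less_one] by meson
  from bound[OF this, of N1] have "(\<lambda>x. s N1 x - G x) \<in> L2_fun M"
    by (auto simp: L2_fun_def)
  from L2_fun_diff[OF s[of N1] this] have G: "G \<in> L2_fun M"
    by simp
  have "(\<lambda>n. expectation (\<lambda>x. (s n x - G x)\<^sup>2)) \<longlonglongrightarrow> 0"
  proof (rule LIMSEQ_I)
    fix e :: real assume "e > 0"
    then obtain N where "\<And>i j. i \<ge> N \<Longrightarrow> j \<ge> N \<Longrightarrow> expectation (\<lambda>x. (s i x - s j x)\<^sup>2) < e / 2"
      using Cauchy[of "e/2"] by (meson half_gt_zero)
    from bound[OF this] \<open>e > 0\<close> show "\<exists>N. \<forall>n\<ge>N. norm (expectation (\<lambda>x. (s n x - G x)\<^sup>2) - 0) < e"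
      by (intro exI[of _ N]) fastforce
  qed
  with G show thesis by (rule that)
qed

end

subsection \<open>The orthonormal family of products of the \<open>Y\<^sub>k\<close>\<close>

text \<open>A subset of \<open>{..<Suc N}\<close> either avoids \<open>N\<close> or is
  \<open>insert N A\<close> for a unique \<open>A\<close> in \<open>Pow {..<N}\<close>. The split
  drives the induction on the number of coordinates and the telescoping of the series.\<close>

lemma sum_Pow_lessThan_Suc:
  fixes f :: "nat set \<Rightarrow> 'a::comm_monoid_add"
  shows "(\<Sum>A\<in>Pow {..<Suc N}. f A) = (\<Sum>A\<in>Pow {..<N}. f A) + (\<Sum>A\<in>Pow {..<N}. f (insert N A))"
proof -
  have "inj_on (insert N) (Pow {..<N})"
    by (rule inj_onI) (metis Pow_iff insert_ident lessThan_iff less_irrefl subsetD)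
  then have "(\<Sum>A\<in>insert N ` Pow {..<N}. f A) = (\<Sum>A\<in>Pow {..<N}. f (insert N A))"
    by (simp add: sum.reindex)
  moreover have "Pow {..<N} \<inter> insert N ` Pow {..<N} = {}"
    by auto
  ultimately show ?thesis
    by (simp add: lessThan_Suc Pow_insert sum.union_disjoint)
qed

section \<open>The law of one coordinate and the product measure\<close>

definition coin :: "real \<Rightarrow> real measure" where
  "coin q = point_measure {-1, 1} (\<lambda>x. ennreal (if x = 1 then q else 1 - q))"

lemma measurable_coin: fixes g :: "real \<Rightarrow> real" shows "g \<in> borel_measurable (coin q)"
  by (simp add: coin_def)

lemma integrable_coin: "integrable (coin q) (g :: real \<Rightarrow> real)"
  by (simp add: coin_def integrable_point_measure_finite)

lemma integral_coin:
  assumes "0 \<le> q" "q \<le> 1"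
  shows "integral\<^sup>L (coin q) g = q * g 1 + (1 - q) * (g (-1) :: real)"
  using assms by (simp add: coin_def lebesgue_integral_point_measure_finite)

lemma prob_space_coin:
  assumes "0 \<le> q" "q \<le> 1"
  shows "prob_space (coin q)"
proof -
  have "emeasure (coin q) {-1, 1} = ennreal (1 - q) + ennreal q"
    by (simp add: coin_def emeasure_point_measure_finite)
  also have "\<dots> = 1"
    using assms by (simp flip: ennreal_plus)
  finally show ?thesis
    by (intro prob_spaceI) (simp add: coin_def space_point_measure)
qed

lemma walk_measure_eq: "walk_measure p = (\<Pi>\<^sub>M k\<in>UNIV. coin (p k))"
  by (simp add: walk_measure_def coin_def)

lemma space_walk_measure: "\<omega> \<in> space (walk_measure p) \<longleftrightarrow> (\<forall>k. \<omega> k = -1 \<or> \<omega> k = 1)"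
  by (auto simp: walk_measure_eq space_PiM coin_def space_point_measure PiE_iff)

lemma measurable_coordinate:
  fixes g :: "real \<Rightarrow> real"
  shows "(\<lambda>\<omega>. g (\<omega> k)) \<in> borel_measurable (walk_measure p)"
proof -
  have "(\<lambda>\<omega>. \<omega> k) \<in> measurable (walk_measure p) (coin (p k))"
    unfolding walk_measure_eq by measurable
  from measurable_compose[OF this measurable_coin] show ?thesis .
qed

text \<open>The Walsh functions of the biased walk. A product over distinct indices ignores their
  order, so sets replace tuples; only finite \<open>A\<close> are meant.\<close>

definition Yprod :: "(nat \<Rightarrow> real) \<Rightarrow> nat set \<Rightarrow> (nat \<Rightarrow> real) \<Rightarrow> real" where
  "Yprod p A \<omega> = (\<Prod>i\<in>A. Y p i \<omega>)"

definition chaos_coeff :: "(nat \<Rightarrow> real) \<Rightarrow> ((nat \<Rightarrow> real) \<Rightarrow> real) \<Rightarrow> nat set \<Rightarrow> real" where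
  "chaos_coeff p G A = (\<integral>\<omega>. G \<omega> * Yprod p A \<omega> \<partial>walk_measure p)"

definition Yspan :: "(nat \<Rightarrow> real) \<Rightarrow> (nat set \<Rightarrow> real) \<Rightarrow> nat set set \<Rightarrow> (nat \<Rightarrow> real) \<Rightarrow> real" where
  "Yspan p a T \<omega> = (\<Sum>A\<in>T. a A * Yprod p A \<omega>)"

locale bernoulli_walk =
  fixes p :: "nat \<Rightarrow> real"
  assumes p_pos: "0 < p k" and p_less_1: "p k < 1"
begin

abbreviation "M \<equiv> walk_measure p"

sublocale prob_space M
  unfolding walk_measure_eq
  using p_pos p_less_1 by (intro prob_space_PiM prob_space_coin) (auto intro: less_imp_le)

text \<open>The finitely many coordinates in \<open>A\<close> have the product of their coin laws as
  joint law, and there Fubini splits the integral into one factor per coordinate.\<close>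

lemma
  fixes g :: "nat \<Rightarrow> real \<Rightarrow> real"
  assumes A: "finite A"
  shows integrable_prod_coordinates: "integrable M (\<lambda>\<omega>. \<Prod>i\<in>A. g i (\<omega> i))"
    and integral_prod_coordinates:
      "(\<integral>\<omega>. (\<Prod>i\<in>A. g i (\<omega> i)) \<partial>M) = (\<Prod>i\<in>A. p i * g i 1 + (1 - p i) * g i (-1))"
proof -
  have coin: "prob_space (coin (p i))" for i
    using p_pos[of i] p_less_1[of i] by (intro prob_space_coin) auto
  interpret product_sigma_finite "\<lambda>i. coin (p i)"
    by (simp add: product_sigma_finite_def coin prob_space_imp_sigma_finite)
  let ?P = "Pi\<^sub>M A (\<lambda>i. coin (p i))" and ?r = "\<lambda>\<omega>. \<lambda>i\<in>A. \<omega> i :: real" and ?f = "\<lambda>x. \<Prod>i\<in>A. g i (x i)"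
  have distr: "distr M ?P ?r = ?P"
    unfolding walk_measure_eq using distr_PiM_reindex[of UNIV "\<lambda>i. coin (p i)" id A] coin by simp
  have r: "?r \<in> measurable M ?P"
    unfolding walk_measure_eq by measurable
  have f: "?f \<in> borel_measurable ?P"
  proof (rule borel_measurable_prod)
    show "(\<lambda>x. g i (x i)) \<in> borel_measurable ?P" if "i \<in> A" for i
      by (rule measurable_compose[OF measurable_component_singleton[OF that] measurable_coin])
  qed
  have eq: "?f (?r \<omega>) = ?f \<omega>" for \<omega>
    by simp
  have "integrable ?P ?f"
    by (intro product_integrable_prod A integrable_coin)
  then have "integrable (distr M ?P ?r) ?f"
    by (simp only: distr)
  from integrable_distr[OF r this] show "integrable M ?f"
    by simp
  have "integral\<^sup>L M ?f = integral\<^sup>L (distr M ?P ?r) ?f"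
    by (subst integral_distr[OF r f]) simp
  also have "\<dots> = (\<Prod>i\<in>A. integral\<^sup>L (coin (p i)) (g i))"
    unfolding distr by (intro product_integral_prod A integrable_coin)
  also have "\<dots> = (\<Prod>i\<in>A. p i * g i 1 + (1 - p i) * g i (-1))"
    using p_pos p_less_1 by (intro prod.cong refl integral_coin) (auto intro: less_imp_le)
  finally show "integral\<^sup>L M ?f = (\<Prod>i\<in>A. p i * g i 1 + (1 - p i) * g i (-1))" .
qed

abbreviation sd :: "nat \<Rightarrow> real" where
  "sd k \<equiv> sqrt (p k * (1 - p k))"

lemma sd_pos: "sd k > 0"
  using p_pos[of k] p_less_1[of k] by simp

lemma sd_sq: "sd k * sd k = p k * (1 - p k)"
  using p_pos[of k] p_less_1[of k] by simp

text \<open>These are the values of \<open>Y p k\<close> at coordinate 1 and at coordinate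
  -1.\<close>

lemma Y_value:
  "((1 - p k) - p k + 1) / (2 * sd k) = (1 - p k) / sd k"
  "((1 - p k) - p k + (-1)) / (2 * sd k) = - p k / sd k"
proof -
  have "((1 - q) - q + 1) / (2 * s) = (1 - q) / s" "((1 - q) - q + (-1)) / (2 * s) = - q / s"
    if "s > 0" for q s :: real
    using that by (simp_all add: field_simps)
  from this[OF sd_pos] show
    "((1 - p k) - p k + 1) / (2 * sd k) = (1 - p k) / sd k"
    "((1 - p k) - p k + (-1)) / (2 * sd k) = - p k / sd k" .
qed

lemma measurable_Y [measurable]: "Y p k \<in> borel_measurable M"
  using measurable_coordinate[of "\<lambda>x. ((1 - p k) - p k + x) / (2 * sqrt (p k * (1 - p k)))" k p]
  by (simp add: Y_def[abs_def] X_def)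

lemma measurable_Yprod [measurable]: "Yprod p A \<in> borel_measurable M"
  unfolding Yprod_def[abs_def] by measurable

lemma Yprod_L2 [simp]:
  assumes "finite A"
  shows "Yprod p A \<in> L2_fun M"
proof -
  have "integrable M (\<lambda>\<omega>. (Yprod p A \<omega>)\<^sup>2)"
    using integrable_prod_coordinates[OF assms,
        of "\<lambda>k x. (((1 - p k) - p k + x) / (2 * sqrt (p k * (1 - p k))))\<^sup>2"]
    by (simp add: Yprod_def Y_def X_def prod_power_distrib)
  then show ?thesis
    by (simp add: L2_fun_def)
qed

lemma Yprod_empty [simp]: "Yprod p {} \<omega> = 1"
  by (simp add: Yprod_def)

lemma Yprod_insert: "finite A \<Longrightarrow> k \<notin> A \<Longrightarrow> Yprod p (insert k A) \<omega> = Y p k \<omega> * Yprod p A \<omega>"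
  by (simp add: Yprod_def)

text \<open>By independence the integral is a product over \<open>A \<union> B\<close>. An index in
  both sets contributes \<open>E[Y_k^2] = 1\<close>, an index in exactly one contributes
  \<open>E[Y_k] = 0\<close>.\<close>

lemma Yprod_orthonormal:
  assumes A: "finite A" and B: "finite B"
  shows "(\<integral>\<omega>. Yprod p A \<omega> * Yprod p B \<omega> \<partial>M) = (if A = B then 1 else 0)"
proof -
  define y where "y k x = ((1 - p k) - p k + x) / (2 * sd k)" for k x
  \<comment> \<open>Both products are extended by factors 1 to the common index set
    \<open>A \<union> B\<close>.\<close>
  define g where "g k x = (if k \<in> A then y k x else 1) * (if k \<in> B then y k x else 1)" for k x
  have y: "y k 1 = (1 - p k) / sd k" "y k (-1) = - p k / sd k" for k
    by (simp_all only: y_def Y_value)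
  have "Yprod p A \<omega> * Yprod p B \<omega> = (\<Prod>k\<in>A \<union> B. g k (\<omega> k))" for \<omega>
  proof -
    have "(\<Prod>k\<in>A \<union> B. if k \<in> A then y k (\<omega> k) else 1) = (\<Prod>k\<in>A. y k (\<omega> k))"
      "(\<Prod>k\<in>A \<union> B. if k \<in> B then y k (\<omega> k) else 1) = (\<Prod>k\<in>B. y k (\<omega> k))"
      using A B by (auto intro!: prod.mono_neutral_cong_right)
    then show ?thesis
      by (simp add: Yprod_def Y_def X_def y_def g_def prod.distrib)
  qed
  then have "(\<integral>\<omega>. Yprod p A \<omega> * Yprod p B \<omega> \<partial>M)
      = (\<Prod>k\<in>A \<union> B. p k * g k 1 + (1 - p k) * g k (-1))"
    using A B by (simp add: integral_prod_coordinates)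
  also have "\<dots> = (\<Prod>k\<in>A \<union> B. if k \<in> A \<and> k \<in> B then 1 else 0)"
  proof (rule prod.cong[OF refl])
    fix k assume "k \<in> A \<union> B"
    have "p k * (y k 1 * y k 1) + (1 - p k) * (y k (-1) * y k (-1))
        = (p k * (1 - p k)) * ((1 - p k) + p k) / (sd k * sd k)"
    \<comment> \<open>With a variable in place of the square root this is plain field algebra;
      \<open>sd_sq\<close> removes the root afterwards.\<close>
    proof -
      have "q * ((1 - q) / s * ((1 - q) / s)) + (1 - q) * (- q / s * (- q / s)) = q * (1 - q) * (1 - q + q) / (s * s)"
        for q s :: real
        by (simp add: algebra_simps add_divide_distrib diff_divide_distrib)
      then show ?thesis
        unfolding y .
    qed
    also have "\<dots> = 1"
      unfolding sd_sq using p_pos[of k] p_less_1[of k] by simp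
    finally have "p k * (y k 1 * y k 1) + (1 - p k) * (y k (-1) * y k (-1)) = 1" .
    moreover have "p k * y k 1 + (1 - p k) * y k (-1) = 0"
      unfolding y by simp
    ultimately show "p k * g k 1 + (1 - p k) * g k (-1) = (if k \<in> A \<and> k \<in> B then 1 else 0)"
      using \<open>k \<in> A \<union> B\<close> by (auto simp: g_def)
  qed
  also have "\<dots> = (if A = B then 1 else 0)"
    using A B by (auto)
  finally show ?thesis .
qed

section \<open>Coefficients, finite combinations and Bessel's inequality\<close>

lemma Yspan_L2:
  assumes "\<And>A. A \<in> T \<Longrightarrow> finite A"
  shows "Yspan p a T \<in> L2_fun M"
  unfolding Yspan_def[abs_def] using assms by (intro L2_fun_sum L2_fun_cmult Yprod_L2)

lemma integrable_chaos_coeff: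
  assumes "G \<in> L2_fun M" "finite A"
  shows "integrable M (\<lambda>\<omega>. G \<omega> * Yprod p A \<omega>)"
  using assms by (intro L2_fun_mult_integrable) auto

lemma chaos_coeff_add:
  assumes "G \<in> L2_fun M" "H \<in> L2_fun M" "finite A"
  shows "chaos_coeff p (\<lambda>\<omega>. G \<omega> + H \<omega>) A = chaos_coeff p G A + chaos_coeff p H A"
  using assms integrable_chaos_coeff by (simp add: chaos_coeff_def distrib_right)

lemma chaos_coeff_diff:
  assumes "G \<in> L2_fun M" "H \<in> L2_fun M" "finite A"
  shows "chaos_coeff p (\<lambda>\<omega>. G \<omega> - H \<omega>) A = chaos_coeff p G A - chaos_coeff p H A"
  using assms integrable_chaos_coeff by (simp add: chaos_coeff_def left_diff_distrib)

lemma chaos_coeff_cmult: "chaos_coeff p (\<lambda>\<omega>. c * G \<omega>) A = c * chaos_coeff p G A"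
  by (simp add: chaos_coeff_def mult.assoc)

lemma chaos_coeff_sum:
  assumes "\<And>i. i \<in> I \<Longrightarrow> G i \<in> L2_fun M" "finite A"
  shows "chaos_coeff p (\<lambda>\<omega>. \<Sum>i\<in>I. G i \<omega>) A = (\<Sum>i\<in>I. chaos_coeff p (G i) A)"
  using assms integrable_chaos_coeff by (simp add: chaos_coeff_def sum_distrib_right)

lemma chaos_coeff_cong_AE:
  assumes "AE \<omega> in M. G \<omega> = H \<omega>" "G \<in> borel_measurable M" "H \<in> borel_measurable M"
  shows "chaos_coeff p G A = chaos_coeff p H A"
proof -
  note [measurable] = assms(2,3)
  show ?thesis
    unfolding chaos_coeff_def using assms(1) by (intro integral_cong_AE) auto
qed

lemma chaos_coeff_Yprod:
  "finite A \<Longrightarrow> finite B \<Longrightarrow> chaos_coeff p (Yprod p B) A = (if A = B then 1 else 0)"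
  by (auto simp: chaos_coeff_def Yprod_orthonormal)

lemma chaos_coeff_Yspan:
  assumes "finite T" "\<And>A. A \<in> T \<Longrightarrow> finite A" "finite A"
  shows "chaos_coeff p (Yspan p a T) A = (if A \<in> T then a A else 0)"
proof -
  have "chaos_coeff p (Yspan p a T) A = (\<Sum>B\<in>T. chaos_coeff p (\<lambda>\<omega>. a B * Yprod p B \<omega>) A)"
    unfolding Yspan_def[abs_def] using assms by (intro chaos_coeff_sum L2_fun_cmult) auto
  also have "\<dots> = (\<Sum>B\<in>T. if A = B then a B else 0)"
    using assms by (intro sum.cong refl) (auto simp: chaos_coeff_cmult chaos_coeff_Yprod)
  finally show ?thesis
    using assms by simp
qed

lemma integral_mult_Yspan:
  assumes "G \<in> L2_fun M" "\<And>A. A \<in> T \<Longrightarrow> finite A"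
  shows "(\<integral>\<omega>. G \<omega> * Yspan p a T \<omega> \<partial>M) = (\<Sum>A\<in>T. a A * chaos_coeff p G A)"
proof -
  have "(\<integral>\<omega>. G \<omega> * Yspan p a T \<omega> \<partial>M) = (\<integral>\<omega>. (\<Sum>A\<in>T. a A * (G \<omega> * Yprod p A \<omega>)) \<partial>M)"
    by (simp add: Yspan_def sum_distrib_left algebra_simps)
  also have "\<dots> = (\<Sum>A\<in>T. a A * chaos_coeff p G A)"
    using assms integrable_chaos_coeff by (simp add: chaos_coeff_def)
  finally show ?thesis .
qed

lemma integral_power2_Yspan:
  assumes "finite T" "\<And>A. A \<in> T \<Longrightarrow> finite A"
  shows "(\<integral>\<omega>. (Yspan p a T \<omega>)\<^sup>2 \<partial>M) = (\<Sum>A\<in>T. (a A)\<^sup>2)"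
  using integral_mult_Yspan[OF Yspan_L2, of T T a a] assms
  by (simp add: power2_eq_square chaos_coeff_Yspan)

text \<open>Expand the square, use orthonormality and complete the square in each coefficient. The
  last sum vanishes when \<open>a\<close> is \<open>chaos_coeff p G\<close>, so these coefficients
  give the best approximation over \<open>T\<close>.\<close>

lemma integral_power2_diff_Yspan:
  assumes G: "G \<in> L2_fun M" and T: "finite T" "\<And>A. A \<in> T \<Longrightarrow> finite A"
  shows "(\<integral>\<omega>. (G \<omega> - Yspan p a T \<omega>)\<^sup>2 \<partial>M)
    = (\<integral>\<omega>. (G \<omega>)\<^sup>2 \<partial>M) - (\<Sum>A\<in>T. (chaos_coeff p G A)\<^sup>2) + (\<Sum>A\<in>T. (a A - chaos_coeff p G A)\<^sup>2)"
proof -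
  have S: "Yspan p a T \<in> L2_fun M"
    using T by (intro Yspan_L2)
  have "(\<integral>\<omega>. (G \<omega> - Yspan p a T \<omega>)\<^sup>2 \<partial>M)
      = (\<integral>\<omega>. (G \<omega>)\<^sup>2 + (Yspan p a T \<omega>)\<^sup>2 - 2 * (G \<omega> * Yspan p a T \<omega>) \<partial>M)"
    by (simp add: power2_diff mult.assoc)
  also have "\<dots> = (\<integral>\<omega>. (G \<omega>)\<^sup>2 \<partial>M) + (\<Sum>A\<in>T. (a A)\<^sup>2) - 2 * (\<Sum>A\<in>T. a A * chaos_coeff p G A)"
    using T G L2_funD(2)[OF G] L2_funD(2)[OF S] L2_fun_mult_integrable[OF G S]
    by (simp add: integral_power2_Yspan integral_mult_Yspan)
  also have "\<dots> = (\<integral>\<omega>. (G \<omega>)\<^sup>2 \<partial>M) - (\<Sum>A\<in>T. (chaos_coeff p G A)\<^sup>2)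
      + (\<Sum>A\<in>T. (a A - chaos_coeff p G A)\<^sup>2)"
    by (simp add: power2_diff sum.distrib sum_subtractf sum_distrib_left mult.assoc)
  finally show ?thesis .
qed

text \<open>Bessel's inequality for a single index set. It makes each coefficient continuous with
  respect to the L2 norm.\<close>

lemma power2_chaos_coeff_le:
  assumes "G \<in> L2_fun M" "finite A"
  shows "(chaos_coeff p G A)\<^sup>2 \<le> (\<integral>\<omega>. (G \<omega>)\<^sup>2 \<partial>M)"
proof -
  have "0 \<le> (\<integral>\<omega>. (G \<omega> - Yspan p (chaos_coeff p G) {A} \<omega>)\<^sup>2 \<partial>M)"
    by (rule integral_nonneg_AE) simp
  then show ?thesis
    using assms by (subst (asm) integral_power2_diff_Yspan) auto
qed

subsection \<open>Approximation by finite chaos sums\<close>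

definition chaos_sum :: "nat \<Rightarrow> ((nat \<Rightarrow> real) \<Rightarrow> real) \<Rightarrow> (nat \<Rightarrow> real) \<Rightarrow> real" where
  "chaos_sum N G = Yspan p (chaos_coeff p G) (Pow {..<N})"

text \<open>Membership in the closed linear span of the products, phrased through the partial sums
  of the function itself. Chaos elements, their gradients and their conditional expectations all
  have this property.\<close>

definition chaotic :: "((nat \<Rightarrow> real) \<Rightarrow> real) \<Rightarrow> bool" where
  "chaotic G \<longleftrightarrow> G \<in> L2_fun M \<and> (\<lambda>N. \<integral>\<omega>. (G \<omega> - chaos_sum N G \<omega>)\<^sup>2 \<partial>M) \<longlonglongrightarrow> 0"

lemma finite_Pow_lessThan: "A \<in> Pow {..<N} \<Longrightarrow> finite A" for N :: nat
  using finite_subset by auto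

lemma chaos_sum_L2: "chaos_sum N G \<in> L2_fun M"
  unfolding chaos_sum_def by (intro Yspan_L2 finite_Pow_lessThan)

lemma chaos_coeff_chaos_sum:
  assumes "finite A"
  shows "chaos_coeff p (chaos_sum N G) A = (if A \<subseteq> {..<N} then chaos_coeff p G A else 0)"
  using chaos_coeff_Yspan[OF _ finite_Pow_lessThan assms, of "Pow {..<N}"] by (simp add: chaos_sum_def)

lemma chaotic_L2: "chaotic G \<Longrightarrow> G \<in> L2_fun M"
  by (simp add: chaotic_def)

text \<open>Any approximating finite combination can be padded with zero coefficients to all of
  \<open>Pow {..<N}\<close>, for every large \<open>N\<close>; the best approximation over that
  family, \<open>chaos_sum N G\<close>, is at least as close.\<close>

lemma chaoticI:
  assumes G: "G \<in> L2_fun M"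
    and approx: "\<And>e. e > 0 \<Longrightarrow> \<exists>T a. finite T \<and> (\<forall>A\<in>T. finite A) \<and> (\<integral>\<omega>. (G \<omega> - Yspan p a T \<omega>)\<^sup>2 \<partial>M) < e"
  shows "chaotic G"
  unfolding chaotic_def
proof (intro conjI G LIMSEQ_I)
  fix e :: real assume "e > 0"
  from approx[OF this] obtain T a where T: "finite T" "\<forall>A\<in>T. finite A"
    and less: "(\<integral>\<omega>. (G \<omega> - Yspan p a T \<omega>)\<^sup>2 \<partial>M) < e"
    by (elim exE conjE)
  have "finite (\<Union>T)"
    using T by (intro finite_Union) auto
  then obtain N0 where N0: "\<Union>T \<subseteq> {..<N0}"
    unfolding finite_nat_iff_bounded ..
  show "\<exists>N0. \<forall>N\<ge>N0. norm ((\<integral>\<omega>. (G \<omega> - chaos_sum N G \<omega>)\<^sup>2 \<partial>M) - 0) < e"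
  proof (intro exI allI impI)
    fix N assume "N0 \<le> N"
    define b where "b A = (if A \<in> T then a A else 0)" for A
    have sub: "T \<subseteq> Pow {..<N}"
      using N0 \<open>N0 \<le> N\<close> by fastforce
    have "Yspan p a T \<omega> = Yspan p b (Pow {..<N}) \<omega>" for \<omega>
      unfolding Yspan_def using sub by (intro sum.mono_neutral_cong_left) (auto simp: b_def)
    then have "(\<integral>\<omega>. (G \<omega> - chaos_sum N G \<omega>)\<^sup>2 \<partial>M) \<le> (\<integral>\<omega>. (G \<omega> - Yspan p a T \<omega>)\<^sup>2 \<partial>M)"
      unfolding chaos_sum_def
      by (simp add: sum_nonneg integral_power2_diff_Yspan[OF G _ finite_Pow_lessThan, of "Pow {..<N}", simplified])
    with less show "norm ((\<integral>\<omega>. (G \<omega> - chaos_sum N G \<omega>)\<^sup>2 \<partial>M) - 0) < e"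
      by simp
  qed
qed

lemma chaotic_Yspan:
  assumes "finite T" "\<And>A. A \<in> T \<Longrightarrow> finite A"
  shows "chaotic (Yspan p a T)"
proof (rule chaoticI)
  show "\<exists>T' a'. finite T' \<and> (\<forall>A\<in>T'. finite A) \<and> (\<integral>\<omega>. (Yspan p a T \<omega> - Yspan p a' T' \<omega>)\<^sup>2 \<partial>M) < e"
    if "e > 0" for e
    using assms that by (intro exI[of _ T] exI[of _ a]) simp
  show "Yspan p a T \<in> L2_fun M"
    using assms(2) by (rule Yspan_L2)
qed

lemma chaotic_add:
  assumes "chaotic G" "chaotic H"
  shows "chaotic (\<lambda>\<omega>. G \<omega> + H \<omega>)"
proof -
  have L2: "G \<in> L2_fun M" "H \<in> L2_fun M"
    using assms chaotic_L2 by auto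
  have sum: "chaos_sum N (\<lambda>\<omega>. G \<omega> + H \<omega>) \<omega> = chaos_sum N G \<omega> + chaos_sum N H \<omega>" for N \<omega>
    unfolding chaos_sum_def Yspan_def sum.distrib[symmetric]
    by (intro sum.cong refl) (simp add: chaos_coeff_add[OF L2] finite_Pow_lessThan distrib_right finite_subset)
  have "(\<lambda>N. \<integral>\<omega>. (G \<omega> + H \<omega> - chaos_sum N (\<lambda>\<omega>. G \<omega> + H \<omega>) \<omega>)\<^sup>2 \<partial>M) \<longlonglongrightarrow> 0"
  proof (rule tendsto_sandwich[OF always_eventually always_eventually tendsto_const])
    show "\<forall>N. 0 \<le> (\<integral>\<omega>. (G \<omega> + H \<omega> - chaos_sum N (\<lambda>\<omega>. G \<omega> + H \<omega>) \<omega>)\<^sup>2 \<partial>M)"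
      by simp
    show "\<forall>N. (\<integral>\<omega>. (G \<omega> + H \<omega> - chaos_sum N (\<lambda>\<omega>. G \<omega> + H \<omega>) \<omega>)\<^sup>2 \<partial>M)
        \<le> 2 * (\<integral>\<omega>. (G \<omega> - chaos_sum N G \<omega>)\<^sup>2 \<partial>M) + 2 * (\<integral>\<omega>. (H \<omega> - chaos_sum N H \<omega>)\<^sup>2 \<partial>M)"
      using integral_power2_sum_le[OF L2_fun_diff[OF L2(1) chaos_sum_L2] L2_fun_diff[OF L2(2) chaos_sum_L2]]
      by (simp add: sum algebra_simps)
    show "(\<lambda>N. 2 * (\<integral>\<omega>. (G \<omega> - chaos_sum N G \<omega>)\<^sup>2 \<partial>M) + 2 * (\<integral>\<omega>. (H \<omega> - chaos_sum N H \<omega>)\<^sup>2 \<partial>M)) \<longlonglongrightarrow> 0"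
      using assms unfolding chaotic_def by (auto intro!: tendsto_eq_intros)
  qed
  then show ?thesis
    using L2_fun_add[OF L2] by (simp add: chaotic_def)
qed

lemma chaotic_cmult:
  assumes "chaotic G"
  shows "chaotic (\<lambda>\<omega>. c * G \<omega>)"
proof -
  have "c * G \<omega> - chaos_sum N (\<lambda>\<omega>. c * G \<omega>) \<omega> = c * (G \<omega> - chaos_sum N G \<omega>)" for N \<omega>
    by (simp add: chaos_sum_def Yspan_def chaos_coeff_cmult sum_distrib_left right_diff_distrib mult.assoc)
  then show ?thesis
    using assms unfolding chaotic_def
    by (auto simp: power_mult_distrib L2_fun_cmult intro!: tendsto_mult_right_zero)
qed

lemma chaotic_sum:
  assumes "finite I" "\<And>i. i \<in> I \<Longrightarrow> chaotic (G i)"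
  shows "chaotic (\<lambda>\<omega>. \<Sum>i\<in>I. G i \<omega>)"
  using assms
proof (induction I)
  case empty
  then show ?case
    using chaotic_Yspan[of "{}"] by (simp add: Yspan_def[abs_def])
qed (auto intro: chaotic_add)

lemma chaotic_cong_AE:
  assumes G: "chaotic G" and H: "H \<in> borel_measurable M" and eq: "AE \<omega> in M. H \<omega> = G \<omega>"
  shows "chaotic H"
proof -
  note [measurable] = H L2_funD(1)[OF chaotic_L2[OF G]] L2_funD(1)[OF chaos_sum_L2]
  have "chaos_sum N H = chaos_sum N G" for N
    using chaos_coeff_cong_AE[OF eq] by (simp add: chaos_sum_def Yspan_def[abs_def])
  moreover have "(\<integral>\<omega>. (H \<omega> - chaos_sum N G \<omega>)\<^sup>2 \<partial>M) = (\<integral>\<omega>. (G \<omega> - chaos_sum N G \<omega>)\<^sup>2 \<partial>M)" for N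
    using eq by (intro integral_cong_AE) auto
  ultimately show ?thesis
    using G L2_fun_cong_AE[OF chaotic_L2[OF G] H eq] by (simp add: chaotic_def)
qed

text \<open>The difference is again \<open>chaotic\<close>, and all its coefficients vanish. Its
  partial sums are therefore 0, and so is their L2 limit.\<close>

lemma chaotic_unique:
  assumes G: "chaotic G" and H: "chaotic H"
    and eq: "\<And>A. finite A \<Longrightarrow> chaos_coeff p G A = chaos_coeff p H A"
  shows "AE \<omega> in M. G \<omega> = H \<omega>"
proof -
  let ?D = "\<lambda>\<omega>. G \<omega> - H \<omega>"
  have D: "chaotic ?D"
    using chaotic_add[OF G chaotic_cmult[OF H, of "-1"]] by simp
  have L2: "?D \<in> L2_fun M"
    using D by (rule chaotic_L2)
  have "chaos_coeff p ?D A = 0" if "finite A" for A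
    using that by (simp add: chaos_coeff_diff chaotic_L2 G H eq)
  then have "chaos_sum N ?D \<omega> = 0" for N \<omega>
    unfolding chaos_sum_def Yspan_def by (intro sum.neutral) (auto simp: finite_subset)
  then have "(\<integral>\<omega>. (?D \<omega>)\<^sup>2 \<partial>M) = 0"
    using D by (simp add: chaotic_def LIMSEQ_const_iff)
  then have "AE \<omega> in M. (?D \<omega>)\<^sup>2 = 0"
    using L2_funD(2)[OF L2] by (subst (asm) integral_nonneg_eq_0_iff_AE) auto
  then show ?thesis
    by simp
qed

subsection \<open>Conditional expectations\<close>

text \<open>Hence \<open>p k + sd k * Y p k \<omega>\<close> is the indicator of
  \<open>\<omega> k = 1\<close>, and \<open>1 - p k - sd k * Y p k \<omega>\<close> is that of
  \<open>\<omega> k = -1\<close>.\<close>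

lemma sd_Y: "\<omega> k = 1 \<Longrightarrow> sd k * Y p k \<omega> = 1 - p k" "\<omega> k = -1 \<Longrightarrow> sd k * Y p k \<omega> = - p k"
  using sd_pos[of k] by (simp_all only: Y_def X_def Y_value times_divide_eq_right nonzero_mult_div_cancel_left less_imp_neq[symmetric] not_False_eq_True)

text \<open>Induction on the number of coordinates: fix the last one to 1 and to -1, expand both
  restrictions, and recombine them with the two indicators, which are affine in
  \<open>Y p N\<close>.\<close>

lemma depends_on_prefix_imp_Yspan:
  fixes h :: "(nat \<Rightarrow> real) \<Rightarrow> real"
  assumes "\<And>\<omega> \<omega>'. \<omega> \<in> space M \<Longrightarrow> \<omega>' \<in> space M \<Longrightarrow> (\<And>i. i < N \<Longrightarrow> \<omega> i = \<omega>' i) \<Longrightarrow> h \<omega> = h \<omega>'"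
  shows "\<exists>a. \<forall>\<omega>\<in>space M. h \<omega> = Yspan p a (Pow {..<N}) \<omega>"
  using assms
proof (induction N arbitrary: h)
  case 0
  have "h \<omega> = h (\<lambda>_. 1)" if "\<omega> \<in> space M" for \<omega>
    using 0[of \<omega> "\<lambda>_. 1"] that by (simp add: space_walk_measure)
  then show ?case
    by (intro exI[of _ "\<lambda>_. h (\<lambda>_. 1)"]) (simp add: Yspan_def)
next
  case (Suc N)
  have upd: "fun_upd \<omega> N x \<in> space M" if "\<omega> \<in> space M" "x = 1 \<or> x = -1" for \<omega> x
    using that by (auto simp: space_walk_measure)
  have "\<exists>a. \<forall>\<omega>\<in>space M. h (fun_upd \<omega> N x) = Yspan p a (Pow {..<N}) \<omega>" if x: "x = 1 \<or> x = -1" for x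
  proof (rule Suc.IH)
    fix \<omega> \<omega>' assume *: "\<omega> \<in> space M" "\<omega>' \<in> space M" "\<And>i. i < N \<Longrightarrow> \<omega> i = \<omega>' i"
    show "h (fun_upd \<omega> N x) = h (fun_upd \<omega>' N x)"
      using * x by (intro Suc.prems upd) (auto simp: less_Suc_eq)
  qed
  then obtain a b where a: "\<And>\<omega>. \<omega> \<in> space M \<Longrightarrow> h (fun_upd \<omega> N 1) = Yspan p a (Pow {..<N}) \<omega>"
    and b: "\<And>\<omega>. \<omega> \<in> space M \<Longrightarrow> h (fun_upd \<omega> N (-1)) = Yspan p b (Pow {..<N}) \<omega>"
    by metis
  \<comment> \<open>Collecting terms in \<open>(p N + sd N * Y p N \<omega>) * a A + (1 - p N - sd N
    * Y p N \<omega>) * b A\<close> gives the mean of \<open>a A\<close> and \<open>b A\<close> as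
    the part free of \<open>Y p N\<close>, and \<open>sd N\<close> times their difference as the
    factor of \<open>Y p N\<close>.\<close>
  define c where "c A = (if N \<in> A then sd N * (a (A - {N}) - b (A - {N})) else p N * a A + (1 - p N) * b A)" for A
  have "h \<omega> = Yspan p c (Pow {..<Suc N}) \<omega>" if \<omega>: "\<omega> \<in> space M" for \<omega>
  proof -
    have "Yspan p c (Pow {..<Suc N}) \<omega>
        = (\<Sum>A\<in>Pow {..<N}. c A * Yprod p A \<omega> + c (insert N A) * Yprod p (insert N A) \<omega>)"
      by (simp add: Yspan_def sum_Pow_lessThan_Suc sum.distrib)
    also have "\<dots> = (\<Sum>A\<in>Pow {..<N}. (p N + sd N * Y p N \<omega>) * (a A * Yprod p A \<omega>)
        + (1 - p N - sd N * Y p N \<omega>) * (b A * Yprod p A \<omega>))"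
    proof (intro sum.cong refl)
      fix A assume A: "A \<in> Pow {..<N}"
      then have "N \<notin> A" "finite A"
        by (auto intro: finite_subset)
      then show "c A * Yprod p A \<omega> + c (insert N A) * Yprod p (insert N A) \<omega>
          = (p N + sd N * Y p N \<omega>) * (a A * Yprod p A \<omega>) + (1 - p N - sd N * Y p N \<omega>) * (b A * Yprod p A \<omega>)"
        by (simp add: c_def Yprod_insert algebra_simps)
    qed
    also have "\<dots> = (p N + sd N * Y p N \<omega>) * h (fun_upd \<omega> N 1) + (1 - p N - sd N * Y p N \<omega>) * h (fun_upd \<omega> N (-1))"
      by (simp add: a[OF \<omega>] b[OF \<omega>] Yspan_def sum.distrib sum_distrib_left)
    also have "\<dots> = h \<omega>"
    proof (cases "\<omega> N = 1")
      case True
      then have "sd N * Y p N \<omega> = 1 - p N" "fun_upd \<omega> N 1 = \<omega>"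
        by (simp_all only: sd_Y fun_upd_idem)
      then show ?thesis by simp
    next
      case False
      then have "\<omega> N = -1"
        using \<omega> by (auto simp: space_walk_measure)
      then have "sd N * Y p N \<omega> = - p N" "fun_upd \<omega> N (-1) = \<omega>"
        by (simp_all only: sd_Y fun_upd_idem)
      then show ?thesis by simp
    qed
    finally show ?thesis by simp
  qed
  then show ?case by blast
qed

lemma space_Filt: "space (Filt p n) = space M"
  unfolding Filt_def by (rule space_measure_of) auto

lemma sets_Filt:
  "sets (Filt p n) = sigma_sets (space M) {X i -` A \<inter> space M | i A. int i \<le> n \<and> A \<in> sets borel}"
  unfolding Filt_def by (rule sets_measure_of) auto

lemma subalgebra_Filt: "subalgebra M (Filt p n)"
  unfolding subalgebra_def space_Filt sets_Filt
proof (intro conjI refl sets.sigma_sets_subset subsetI)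
  fix B assume "B \<in> {X i -` A \<inter> space M | i A. int i \<le> n \<and> A \<in> sets borel}"
  then obtain i A where "B = X i -` A \<inter> space M" "A \<in> sets borel"
    by blast
  then show "B \<in> sets M"
    using measurable_sets[OF measurable_coordinate[of "\<lambda>x. x" i p], of A] by (simp add: X_def[abs_def])
qed

sublocale Filt: finite_measure_subalgebra M "Filt p n" for n
  by standard (rule subalgebra_Filt)

text \<open>The generators have this property, and it survives complements and countable unions.
  With the index \<open>int N - 1\<close>, \<open>N\<close> counts the revealed coordinates, and
  \<open>N = 0\<close> gives the trivial \<sigma>-algebra.\<close>

lemma sets_Filt_depends_on_prefix:
  assumes "B \<in> sets (Filt p (int N - 1))" "\<omega> \<in> space M" "\<omega>' \<in> space M" "\<And>i. i < N \<Longrightarrow> \<omega> i = \<omega>' i"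
  shows "\<omega> \<in> B \<longleftrightarrow> \<omega>' \<in> B"
  using assms(1)[unfolded sets_Filt] assms(2-)
proof (induction rule: sigma_sets.induct)
  case (Basic B)
  then show ?case by (auto simp: X_def)
qed auto

lemma measurable_Y_Filt:
  assumes "k < N"
  shows "Y p k \<in> borel_measurable (Filt p (int N - 1))"
proof -
  have "X k \<in> borel_measurable (Filt p (int N - 1))"
  proof (rule measurableI)
    show "X k -` A \<inter> space (Filt p (int N - 1)) \<in> sets (Filt p (int N - 1))" if "A \<in> sets borel" for A
      unfolding sets_Filt space_Filt using assms that by (intro sigma_sets.Basic) auto
  qed simp
  then show ?thesis
    unfolding Y_def[abs_def] by measurable
qed

lemma chaos_sum_measurable_Filt: "chaos_sum N G \<in> borel_measurable (Filt p (int N - 1))"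
  unfolding chaos_sum_def Yspan_def[abs_def] Yprod_def
  by (intro borel_measurable_sum borel_measurable_times borel_measurable_const borel_measurable_prod measurable_Y_Filt) auto

text \<open>The indicator of a set in the \<sigma>-algebra is a combination of products over subsets
  of \<open>{..<N}\<close>. The integral over such a set thus involves only coefficients that
  \<open>G\<close> and \<open>chaos_sum N G\<close> share.\<close>

lemma cond_exp_Filt:
  assumes G: "G \<in> L2_fun M"
  shows "AE \<omega> in M. real_cond_exp M (Filt p (int N - 1)) G \<omega> = chaos_sum N G \<omega>"
proof (rule Filt.real_cond_exp_charact)
  show "integrable M G" "integrable M (chaos_sum N G)"
    using G chaos_sum_L2 L2_fun_integrable by auto
  show "chaos_sum N G \<in> borel_measurable (Filt p (int N - 1))"
    by (rule chaos_sum_measurable_Filt)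
  fix B assume B: "B \<in> sets (Filt p (int N - 1))"
  have "indicator B \<omega> = (indicator B \<omega>' :: real)"
    if "\<omega> \<in> space M" "\<omega>' \<in> space M" "\<And>i. i < N \<Longrightarrow> \<omega> i = \<omega>' i" for \<omega> \<omega>'
    using sets_Filt_depends_on_prefix[OF B that] by (simp add: indicator_def)
  then have "\<exists>a. \<forall>\<omega>\<in>space M. indicator B \<omega> = Yspan p a (Pow {..<N}) \<omega>"
    by (rule depends_on_prefix_imp_Yspan)
  then obtain a where a: "\<forall>\<omega>\<in>space M. indicator B \<omega> = Yspan p a (Pow {..<N}) \<omega>" ..
  have set_integral: "(\<integral>\<omega>\<in>B. H \<omega> \<partial>M) = (\<Sum>A\<in>Pow {..<N}. a A * chaos_coeff p H A)" if H: "H \<in> L2_fun M" for H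
  proof -
    have "(\<integral>\<omega>\<in>B. H \<omega> \<partial>M) = (\<integral>\<omega>. H \<omega> * Yspan p a (Pow {..<N}) \<omega> \<partial>M)"
      unfolding set_lebesgue_integral_def by (intro Bochner_Integration.integral_cong) (simp_all add: a)
    also have "\<dots> = (\<Sum>A\<in>Pow {..<N}. a A * chaos_coeff p H A)"
      using H by (intro integral_mult_Yspan finite_Pow_lessThan)
    finally show ?thesis .
  qed
  have "(\<Sum>A\<in>Pow {..<N}. a A * chaos_coeff p G A) = (\<Sum>A\<in>Pow {..<N}. a A * chaos_coeff p (chaos_sum N G) A)"
    by (intro sum.cong refl) (simp add: chaos_coeff_chaos_sum finite_Pow_lessThan)
  then show "(\<integral>\<omega>\<in>B. G \<omega> \<partial>M) = (\<integral>\<omega>\<in>B. chaos_sum N G \<omega> \<partial>M)"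
    using G by (simp add: set_integral chaos_sum_L2)
qed

subsection \<open>Multiple stochastic integrals\<close>

text \<open>The finite partial sums of the series that defines \<open>J\<close>.\<close>

definition list_sum :: "(nat list \<Rightarrow> real) \<Rightarrow> nat list set \<Rightarrow> (nat \<Rightarrow> real) \<Rightarrow> real" where
  "list_sum f T \<omega> = (\<Sum>is\<in>T. f is * (\<Prod>i\<leftarrow>is. Y p i \<omega>))"

text \<open>Lists of distinct indices with the same underlying set carry the same product, so they
  are grouped by that set.\<close>

lemma list_sum_eq_Yspan:
  assumes "finite T" "T \<subseteq> Delta n"
  shows "list_sum f T = Yspan p (\<lambda>A. \<Sum>is | is \<in> T \<and> set is = A. f is) (set ` T)"
proof
  fix \<omega>
  have "list_sum f T \<omega> = (\<Sum>is\<in>T. f is * Yprod p (set is) \<omega>)"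
    unfolding list_sum_def
  proof (rule sum.cong[OF refl])
    fix "is" assume "is \<in> T"
    then have "distinct is"
      using assms by (auto simp: Delta_def)
    then show "f is * (\<Prod>i\<leftarrow>is. Y p i \<omega>) = f is * Yprod p (set is) \<omega>"
      by (simp add: Yprod_def prod.distinct_set_conv_list)
  qed
  also have "\<dots> = (\<Sum>A\<in>set ` T. \<Sum>is | is \<in> T \<and> set is = A. f is * Yprod p (set is) \<omega>)"
    by (rule sum.image_gen[OF assms(1)])
  also have "\<dots> = (\<Sum>A\<in>set ` T. (\<Sum>is | is \<in> T \<and> set is = A. f is) * Yprod p A \<omega>)"
    by (simp add: sum_distrib_right)
  finally show "list_sum f T \<omega> = Yspan p (\<lambda>A. \<Sum>is | is \<in> T \<and> set is = A. f is) (set ` T) \<omega>"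
    by (simp add: Yspan_def)
qed

lemma list_sum_L2:
  assumes "finite T" "T \<subseteq> Delta n"
  shows "list_sum f T \<in> L2_fun M"
  unfolding list_sum_eq_Yspan[OF assms] by (rule Yspan_L2) auto

text \<open>By orthonormality the squared norm is the sum of the squared group totals. A group
  consists of enumerations of one set of size \<open>n\<close>, hence has at most
  \<open>fact n\<close> members, and Cauchy-Schwarz bounds its squared total.\<close>

lemma integral_power2_list_sum_le:
  assumes T: "finite T" "T \<subseteq> Delta n"
  shows "(\<integral>\<omega>. (list_sum f T \<omega>)\<^sup>2 \<partial>M) \<le> fact n * (\<Sum>is\<in>T. (f is)\<^sup>2)"
proof -
  have "(\<Sum>is | is \<in> T \<and> set is = A. f is)\<^sup>2 \<le> fact n * (\<Sum>is | is \<in> T \<and> set is = A. (f is)\<^sup>2)"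
    if "A \<in> set ` T" for A
  proof -
    let ?T = "{is. is \<in> T \<and> set is = A}"
    obtain js where js: "js \<in> T" "A = set js"
      using \<open>A \<in> set ` T\<close> by blast
    then have "card A = n" "finite A"
      using T by (auto simp: Delta_def distinct_card)
    moreover have "?T \<subseteq> permutations_of_set A"
      using T by (auto simp: Delta_def permutations_of_set_def)
    ultimately have "card ?T \<le> fact n"
      using card_mono[of "permutations_of_set A" ?T] by simp
    then have "real (card ?T) \<le> fact n"
      by (metis of_nat_fact of_nat_le_iff)
    have "(\<Sum>is\<in>?T. f is)\<^sup>2 \<le> (\<Sum>is\<in>?T. (f is)\<^sup>2) * real (card ?T)"
      by (rule sum_squared_le_sum_of_squares)
    also have "\<dots> \<le> (\<Sum>is\<in>?T. (f is)\<^sup>2) * fact n"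
      by (intro mult_left_mono \<open>real (card ?T) \<le> fact n\<close> sum_nonneg) auto
    finally show ?thesis
      by (simp add: mult.commute)
  qed
  then have "(\<Sum>A\<in>set ` T. (\<Sum>is | is \<in> T \<and> set is = A. f is)\<^sup>2)
      \<le> (\<Sum>A\<in>set ` T. fact n * (\<Sum>is | is \<in> T \<and> set is = A. (f is)\<^sup>2))"
    by (rule sum_mono)
  also have "\<dots> = fact n * (\<Sum>is\<in>T. (f is)\<^sup>2)"
    by (simp add: sum_distrib_left[symmetric] sum.image_gen[OF T(1), of "\<lambda>is. (f is)\<^sup>2" set])
  finally show ?thesis
    unfolding list_sum_eq_Yspan[OF T] using T by (subst integral_power2_Yspan) auto
qed

text \<open>Tails of the series are bounded by \<open>fact n\<close> times tails of the sum of
  \<open>(f is)\<^sup>2\<close>. An exhausting sequence of partial sums is therefore Cauchy; its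
  limit is then shown to be the limit along all finite subsets.\<close>

lemma multiple_integral_exists:
  assumes summable: "(\<lambda>is. (f is)\<^sup>2) summable_on Delta n"
  shows "\<exists>G. L2_has_sum M (\<lambda>is \<omega>. f is * (\<Prod>i\<leftarrow>is. Y p i \<omega>)) (Delta n) G"
proof -
  define T where "T N = {is \<in> Delta n. set is \<subseteq> {..<N}}" for N :: nat
  have T: "finite (T N)" "T N \<subseteq> Delta n" for N
  proof -
    have "T N \<subseteq> {is. set is \<subseteq> {..<N} \<and> length is = n}"
      by (auto simp: T_def Delta_def)
    then show "finite (T N)"
      by (rule finite_subset) (simp add: finite_lists_length_eq)
  qed (simp add: T_def)
  have T_mono: "T N \<subseteq> T N'" if "N \<le> N'" for N N'
    using that by (auto simp: T_def subset_iff)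
  have tail: "\<exists>N. \<forall>S. finite S \<longrightarrow> S \<subseteq> Delta n \<longrightarrow> T N \<subseteq> S \<longrightarrow>
      (\<integral>\<omega>. (list_sum f S \<omega> - list_sum f (T N) \<omega>)\<^sup>2 \<partial>M) < e" if "e > 0" for e
  proof -
    \<comment> \<open>The \<open>fact n\<close> cancels the constant of the norm bound; the 2
      restores a strict inequality, since the approximation below is only up to
      \<open>\<le>\<close>.\<close>
    have "e / (2 * fact n) > 0"
      using that by simp
    from infsum_finite_approximation[OF summable this]
    obtain F where F: "finite F" "F \<subseteq> Delta n"
      and dist: "dist (\<Sum>is\<in>F. (f is)\<^sup>2) (\<Sum>\<^sub>\<infinity>is\<in>Delta n. (f is)\<^sup>2) \<le> e / (2 * fact n)"
      by (elim exE conjE)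
    have "finite (\<Union>(set ` F))"
      using F by simp
    then obtain N where N: "\<Union>(set ` F) \<subseteq> {..<N}"
      unfolding finite_nat_iff_bounded ..
    have FT: "F \<subseteq> T N"
      using N F by (auto simp: T_def)
    have "(\<integral>\<omega>. (list_sum f S \<omega> - list_sum f (T N) \<omega>)\<^sup>2 \<partial>M) < e"
      if S: "finite S" "S \<subseteq> Delta n" "T N \<subseteq> S" for S
    proof -
      have "list_sum f S \<omega> - list_sum f (T N) \<omega> = list_sum f (S - T N) \<omega>" for \<omega>
        using S T by (simp add: list_sum_def sum_diff)
      then have "(\<integral>\<omega>. (list_sum f S \<omega> - list_sum f (T N) \<omega>)\<^sup>2 \<partial>M) = (\<integral>\<omega>. (list_sum f (S - T N) \<omega>)\<^sup>2 \<partial>M)"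
        by simp
      also have "\<dots> \<le> fact n * (\<Sum>is\<in>S - T N. (f is)\<^sup>2)"
        using S by (intro integral_power2_list_sum_le) auto
      also have "(\<Sum>is\<in>S - T N. (f is)\<^sup>2) \<le> (\<Sum>is\<in>S - F. (f is)\<^sup>2)"
        using S FT by (intro sum_mono2) auto
      also have "(\<Sum>is\<in>S - F. (f is)\<^sup>2) = (\<Sum>is\<in>S. (f is)\<^sup>2) - (\<Sum>is\<in>F. (f is)\<^sup>2)"
        using S F FT by (intro sum_diff) auto
      also have "(\<Sum>is\<in>S. (f is)\<^sup>2) \<le> (\<Sum>\<^sub>\<infinity>is\<in>Delta n. (f is)\<^sup>2)"
        using S summable by (intro finite_sum_le_infsum) auto
      also have "(\<Sum>\<^sub>\<infinity>is\<in>Delta n. (f is)\<^sup>2) - (\<Sum>is\<in>F. (f is)\<^sup>2) \<le> e / (2 * fact n)"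
        using dist by (simp add: dist_real_def abs_le_iff)
      finally have "(\<integral>\<omega>. (list_sum f S \<omega> - list_sum f (T N) \<omega>)\<^sup>2 \<partial>M) \<le> fact n * (e / (2 * fact n))"
        by simp
      also have "\<dots> < e"
        using \<open>e > 0\<close> by simp
      finally show ?thesis .
    qed
    then show ?thesis by blast
  qed
  have "\<exists>N. \<forall>i\<ge>N. \<forall>j\<ge>N. (\<integral>\<omega>. (list_sum f (T i) \<omega> - list_sum f (T j) \<omega>)\<^sup>2 \<partial>M) < e" if "e > 0" for e
  proof -
    have "e / 4 > 0"
      using that by simp
    from tail[OF this] obtain N where N: "\<forall>S. finite S \<longrightarrow> S \<subseteq> Delta n \<longrightarrow> T N \<subseteq> S \<longrightarrow>
      (\<integral>\<omega>. (list_sum f S \<omega> - list_sum f (T N) \<omega>)\<^sup>2 \<partial>M) < e / 4" ..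
    have "(\<integral>\<omega>. (list_sum f (T i) \<omega> - list_sum f (T j) \<omega>)\<^sup>2 \<partial>M) < e" if "i \<ge> N" "j \<ge> N" for i j
    proof -
      have "(\<integral>\<omega>. (list_sum f (T i) \<omega> - list_sum f (T j) \<omega>)\<^sup>2 \<partial>M)
          \<le> 2 * (\<integral>\<omega>. (list_sum f (T i) \<omega> - list_sum f (T N) \<omega>)\<^sup>2 \<partial>M)
            + 2 * (\<integral>\<omega>. (list_sum f (T N) \<omega> - list_sum f (T j) \<omega>)\<^sup>2 \<partial>M)"
        by (intro integral_power2_triangle list_sum_L2[OF T])
      moreover have "(\<integral>\<omega>. (list_sum f (T i) \<omega> - list_sum f (T N) \<omega>)\<^sup>2 \<partial>M) < e / 4"
        "(\<integral>\<omega>. (list_sum f (T j) \<omega> - list_sum f (T N) \<omega>)\<^sup>2 \<partial>M) < e / 4"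
        using N T T_mono that by auto
      ultimately show ?thesis
        by (simp add: power2_commute[of "list_sum f (T N) _"])
    qed
    then show ?thesis by blast
  qed
  from L2_complete[of "\<lambda>i. list_sum f (T i)", OF list_sum_L2[OF T] this]
  obtain G where G: "G \<in> L2_fun M"
    and lim: "(\<lambda>N. \<integral>\<omega>. (list_sum f (T N) \<omega> - G \<omega>)\<^sup>2 \<partial>M) \<longlonglongrightarrow> 0" .
  have "((\<lambda>S. \<integral>\<omega>. (list_sum f S \<omega> - G \<omega>)\<^sup>2 \<partial>M) \<longlongrightarrow> 0) (finite_subsets_at_top (Delta n))"
  proof (rule tendstoI)
    fix e :: real assume "e > 0"
    \<comment> \<open>Two uses of the factor-2 triangle inequality: the distance from
      \<open>T N\<close> to \<open>G\<close> is below \<open>2 * (e/16) + 2 * (e/16) = e/4\<close>,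
      and that from \<open>S\<close> to \<open>G\<close> is then below
      \<open>2 * (e/16) + 2 * (e/4) < e\<close>.\<close>
    then have "e / 16 > 0" by simp
    from tail[OF this] obtain N where N: "\<forall>S. finite S \<longrightarrow> S \<subseteq> Delta n \<longrightarrow> T N \<subseteq> S \<longrightarrow>
      (\<integral>\<omega>. (list_sum f S \<omega> - list_sum f (T N) \<omega>)\<^sup>2 \<partial>M) < e / 16" ..
    obtain N' where N': "N' \<ge> N" "(\<integral>\<omega>. (list_sum f (T N') \<omega> - G \<omega>)\<^sup>2 \<partial>M) < e / 16"
    proof -
      have "\<forall>\<^sub>F N' in sequentially. (\<integral>\<omega>. (list_sum f (T N') \<omega> - G \<omega>)\<^sup>2 \<partial>M) < e / 16"
        using order_tendstoD(2)[OF lim \<open>e / 16 > 0\<close>] .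
      from eventually_happens'[OF _ eventually_conj[OF this eventually_ge_at_top[of N]]] that
      show thesis by auto
    qed
    have NG: "(\<integral>\<omega>. (list_sum f (T N) \<omega> - G \<omega>)\<^sup>2 \<partial>M) < e / 4"
    proof -
      have "(\<integral>\<omega>. (list_sum f (T N) \<omega> - G \<omega>)\<^sup>2 \<partial>M)
          \<le> 2 * (\<integral>\<omega>. (list_sum f (T N) \<omega> - list_sum f (T N') \<omega>)\<^sup>2 \<partial>M)
            + 2 * (\<integral>\<omega>. (list_sum f (T N') \<omega> - G \<omega>)\<^sup>2 \<partial>M)"
        by (intro integral_power2_triangle list_sum_L2[OF T] G)
      moreover have "(\<integral>\<omega>. (list_sum f (T N') \<omega> - list_sum f (T N) \<omega>)\<^sup>2 \<partial>M) < e / 16"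
        using N T T_mono[OF N'(1)] by auto
      ultimately show ?thesis
        using N'(2) by (simp add: power2_commute[of "list_sum f (T N) _"])
    qed
    have "dist (\<integral>\<omega>. (list_sum f S \<omega> - G \<omega>)\<^sup>2 \<partial>M) 0 < e"
      if S: "finite S" "T N \<subseteq> S" "S \<subseteq> Delta n" for S
    proof -
      have "(\<integral>\<omega>. (list_sum f S \<omega> - G \<omega>)\<^sup>2 \<partial>M)
          \<le> 2 * (\<integral>\<omega>. (list_sum f S \<omega> - list_sum f (T N) \<omega>)\<^sup>2 \<partial>M)
            + 2 * (\<integral>\<omega>. (list_sum f (T N) \<omega> - G \<omega>)\<^sup>2 \<partial>M)"
        by (intro integral_power2_triangle list_sum_L2[OF T] list_sum_L2[OF S(1,3)] G)
      moreover have "(\<integral>\<omega>. (list_sum f S \<omega> - list_sum f (T N) \<omega>)\<^sup>2 \<partial>M) < e / 16"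
        using N S by auto
      ultimately show ?thesis
        using NG \<open>e > 0\<close> by simp
    qed
    then show "\<forall>\<^sub>F S in finite_subsets_at_top (Delta n). dist (\<integral>\<omega>. (list_sum f S \<omega> - G \<omega>)\<^sup>2 \<partial>M) 0 < e"
      unfolding eventually_finite_subsets_at_top using T by (intro exI[of _ "T N"]) simp
  qed
  from tendsto_real_sqrt[OF this]
  have "((\<lambda>S. L2_norm M (\<lambda>\<omega>. list_sum f S \<omega> - G \<omega>)) \<longlongrightarrow> 0) (finite_subsets_at_top (Delta n))"
    by (simp add: L2_norm_def)
  moreover have "(\<lambda>\<omega>. f is * (\<Prod>i\<leftarrow>is. Y p i \<omega>)) \<in> L2_fun M" if "is \<in> Delta n" for "is"
    using list_sum_L2[of "{is}" n f] that by (simp add: list_sum_def[abs_def])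
  ultimately show ?thesis
    using G by (intro exI[of _ G]) (simp add: L2_has_sum_def list_sum_def)
qed

lemma sym_l2D:
  assumes "f \<in> sym_l2 n"
  shows "(\<lambda>is. (f is)\<^sup>2) summable_on {is. length is = n}"
    and "length is = n \<Longrightarrow> mset is = mset js \<Longrightarrow> f is = f js"
  using assms by (auto simp: sym_l2_def)

text \<open>Existence of the limit justifies the choice made in \<open>J\<close>. Convergence is
  restated for squared norms, the form used from here on.\<close>

lemma L2_has_sum_J:
  assumes "f \<in> sym_l2 n" "n > 0"
  shows "J p n f \<in> L2_fun M"
    and "((\<lambda>T. \<integral>\<omega>. (list_sum f T \<omega> - J p n f \<omega>)\<^sup>2 \<partial>M) \<longlongrightarrow> 0) (finite_subsets_at_top (Delta n))"
proof -
  have "(\<lambda>is. (f is)\<^sup>2) summable_on Delta n"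
    by (rule summable_on_subset[OF sym_l2D(1)[OF assms(1)]]) (auto simp: Delta_def)
  from someI_ex[OF multiple_integral_exists[OF this]]
  have J: "L2_has_sum M (\<lambda>is \<omega>. f is * (\<Prod>i\<leftarrow>is. Y p i \<omega>)) (Delta n) (J p n f)"
    using assms(2) by (simp add: J_def)
  then show "J p n f \<in> L2_fun M"
    by (simp add: L2_has_sum_def)
  have "((\<lambda>T. L2_norm M (\<lambda>\<omega>. list_sum f T \<omega> - J p n f \<omega>)) \<longlongrightarrow> 0) (finite_subsets_at_top (Delta n))"
    using J by (simp add: L2_has_sum_def list_sum_def)
  from tendsto_power[OF this, of 2]
  show "((\<lambda>T. \<integral>\<omega>. (list_sum f T \<omega> - J p n f \<omega>)\<^sup>2 \<partial>M) \<longlongrightarrow> 0) (finite_subsets_at_top (Delta n))"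
    by (simp add: L2_norm_def)
qed

lemma chaotic_const: "chaotic (\<lambda>\<omega>. c)"
  using chaotic_Yspan[of "{{}}" "\<lambda>_. c"] by (simp add: Yspan_def[abs_def])

lemma chaotic_J:
  assumes "f \<in> sym_l2 n"
  shows "chaotic (J p n f)"
proof (cases "n = 0")
  case True
  then show ?thesis
    by (simp add: J_def chaotic_const)
next
  case False
  then have n: "n > 0" by simp
  show ?thesis
  proof (rule chaoticI)
    fix e :: real assume "e > 0"
    from order_tendstoD(2)[OF L2_has_sum_J(2)[OF assms n] this]
    obtain T where T: "finite T" "T \<subseteq> Delta n" "(\<integral>\<omega>. (list_sum f T \<omega> - J p n f \<omega>)\<^sup>2 \<partial>M) < e"
      unfolding eventually_finite_subsets_at_top by (metis subset_refl)
    then show "\<exists>T a. finite T \<and> (\<forall>A\<in>T. finite A) \<and> (\<integral>\<omega>. (J p n f \<omega> - Yspan p a T \<omega>)\<^sup>2 \<partial>M) < e"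
      unfolding list_sum_eq_Yspan[OF T(1,2)] power2_commute[of "J p n f _"]
      by (intro exI conjI) auto
  qed (rule L2_has_sum_J[OF assms n])
qed

text \<open>Once a partial sum contains all enumerations of \<open>A\<close>, its coefficient at
  \<open>A\<close> no longer changes, and Bessel's inequality carries this value to the limit. By
  symmetry of \<open>f\<close> it is \<open>fact n\<close> times the value at one enumeration, here
  the sorted one.\<close>

lemma chaos_coeff_J:
  assumes f: "f \<in> sym_l2 n" and A: "finite A"
  shows "chaos_coeff p (J p n f) A = (if card A = n then fact n * f (sorted_list_of_set A) else 0)"
proof (cases "n = 0")
  case True
  have "chaos_coeff p (\<lambda>\<omega>. f []) A = (if A = {} then f [] else 0)"
    using chaos_coeff_Yspan[of "{{}}" A "\<lambda>_. f []"] A by (simp add: Yspan_def[abs_def])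
  then show ?thesis
    using True A by (simp add: J_def)
next
  case False
  then have n: "n > 0" by simp
  \<comment> \<open>All enumerations of \<open>A\<close> if \<open>card A = n\<close>, and the empty
    set otherwise.\<close>
  let ?P = "permutations_of_set A \<inter> Delta n"
  define c where "c = (\<Sum>is\<in>?P. f is)"
  have "(c - chaos_coeff p (J p n f) A)\<^sup>2 \<le> 0"
  proof (rule tendsto_lowerbound[OF L2_has_sum_J(2)[OF f n]])
    have "(c - chaos_coeff p (J p n f) A)\<^sup>2 \<le> (\<integral>\<omega>. (list_sum f T \<omega> - J p n f \<omega>)\<^sup>2 \<partial>M)"
      if T: "finite T" "?P \<subseteq> T" "T \<subseteq> Delta n" for T
    proof -
      have P: "{is. is \<in> T \<and> set is = A} = ?P"
        using T by (auto simp: permutations_of_set_def Delta_def)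
      have "chaos_coeff p (list_sum f T) A = (if A \<in> set ` T then \<Sum>is | is \<in> T \<and> set is = A. f is else 0)"
        unfolding list_sum_eq_Yspan[OF T(1,3)] using T A by (intro chaos_coeff_Yspan) auto
      also have "\<dots> = (\<Sum>is | is \<in> T \<and> set is = A. f is)"
        by (auto intro!: sum.neutral)
      finally have "chaos_coeff p (list_sum f T) A = c"
        by (simp add: P c_def)
      then show ?thesis
        using power2_chaos_coeff_le[OF L2_fun_diff[OF list_sum_L2[OF T(1,3)] L2_has_sum_J(1)[OF f n]] A, of f]
        by (simp add: chaos_coeff_diff[OF list_sum_L2[OF T(1,3)] L2_has_sum_J(1)[OF f n] A])
    qed
    then show "\<forall>\<^sub>F T in finite_subsets_at_top (Delta n).
        (c - chaos_coeff p (J p n f) A)\<^sup>2 \<le> (\<integral>\<omega>. (list_sum f T \<omega> - J p n f \<omega>)\<^sup>2 \<partial>M)"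
      unfolding eventually_finite_subsets_at_top
      by (intro exI[of _ ?P]) auto
  qed simp
  then have "chaos_coeff p (J p n f) A = c"
    by simp
  also have "c = (if card A = n then fact n * f (sorted_list_of_set A) else 0)"
  proof (cases "card A = n")
    case True
    then have P: "?P = permutations_of_set A"
      by (auto simp: permutations_of_set_def Delta_def distinct_card)
    have "f is = f (sorted_list_of_set A)" if "is \<in> permutations_of_set A" for "is"
    proof (rule sym_l2D(2)[OF f])
      show "length is = n"
        using that True by (simp add: length_finite_permutations_of_set)
      show "mset is = mset (sorted_list_of_set A)"
        using permutations_of_setD[OF that] A by (auto simp flip: mset_set_set)
    qed
    then show ?thesis
      using True A by (simp add: c_def P)
  next
    case False
    then have "?P = {}"
      by (auto simp: permutations_of_set_def Delta_def distinct_card)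
    then show ?thesis
      using False by (simp add: c_def)
  qed
  finally show ?thesis .
qed

subsection \<open>The gradient\<close>

text \<open>Only the summand of order \<open>card A\<close> contributes to the coefficient at
  \<open>A\<close>. Conversely, \<open>F\<close> determines these values of the kernels.\<close>

lemma chaos_expansionD:
  assumes "chaos_expansion p n f F"
  shows "chaotic F"
    and "finite A \<Longrightarrow> chaos_coeff p F A
      = (if card A \<le> n then fact (card A) * f (card A) (sorted_list_of_set A) else 0)"
proof -
  let ?S = "\<lambda>\<omega>. \<Sum>m\<le>n. J p m (f m) \<omega>"
  have f: "f m \<in> sym_l2 m" if "m \<le> n" for m
    using assms that by (simp add: chaos_expansion_def)
  have F: "F \<in> borel_measurable M" and eq: "AE \<omega> in M. F \<omega> = ?S \<omega>"
    using assms by (simp_all add: chaos_expansion_def)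
  have S: "chaotic ?S"
    using f by (intro chaotic_sum chaotic_J) auto
  show "chaotic F"
    by (rule chaotic_cong_AE[OF S F eq])
  assume A: "finite A"
  have "chaos_coeff p F A = chaos_coeff p ?S A"
    by (rule chaos_coeff_cong_AE[OF eq F L2_funD(1)[OF chaotic_L2[OF S]]])
  also have "\<dots> = (\<Sum>m\<le>n. chaos_coeff p (J p m (f m)) A)"
    using f A by (intro chaos_coeff_sum chaotic_L2 chaotic_J) auto
  also have "\<dots> = (\<Sum>m\<le>n. if card A = m then fact m * f m (sorted_list_of_set A) else 0)"
    using f A by (intro sum.cong refl chaos_coeff_J) auto
  finally show "chaos_coeff p F A
      = (if card A \<le> n then fact (card A) * f (card A) (sorted_list_of_set A) else 0)"
    by simp
qed

text \<open>Appending \<open>k\<close> is injective, so the sum of squares is dominated by a part of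
  the one for \<open>f\<close>. Permuting the remaining variables changes neither \<open>f\<close>
  nor distinctness.\<close>

lemma sym_l2_partial:
  assumes f: "f \<in> sym_l2 (Suc m)"
  shows "(\<lambda>is. f (is @ [k]) * indicator (Delta (Suc m)) (is @ [k])) \<in> sym_l2 m"
  unfolding sym_l2_def mem_Collect_eq
proof (intro conjI allI impI)
  have "inj_on (\<lambda>is. is @ [k]) {is. length is = m}"
    by (auto intro: inj_onI)
  moreover have "(\<lambda>is. (f is)\<^sup>2) summable_on (\<lambda>is. is @ [k]) ` {is. length is = m}"
    by (rule summable_on_subset[OF sym_l2D(1)[OF f]]) auto
  ultimately have "(\<lambda>is. (f (is @ [k]))\<^sup>2) summable_on {is. length is = m}"
    by (simp add: summable_on_reindex o_def)
  then show "(\<lambda>is. (f (is @ [k]) * indicator (Delta (Suc m)) (is @ [k]))\<^sup>2) summable_on {is. length is = m}"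
    by (rule summable_on_comparison_test) (auto simp: indicator_def)
next
  fix "is" js :: "nat list"
  assume "length is = m \<and> mset is = mset js"
  then have "length is = m" "mset is = mset js" by auto
  have "f (is @ [k]) = f (js @ [k])"
    using \<open>length is = m\<close> \<open>mset is = mset js\<close> by (intro sym_l2D(2)[OF f]) auto
  moreover have "is @ [k] \<in> Delta (Suc m) \<longleftrightarrow> js @ [k] \<in> Delta (Suc m)"
    using mset_eq_length[OF \<open>mset is = mset js\<close>] mset_eq_setD[OF \<open>mset is = mset js\<close>]
      mset_eq_imp_distinct_iff[OF \<open>mset is = mset js\<close>]
    by (simp add: Delta_def)
  ultimately show "f (is @ [k]) * indicator (Delta (Suc m)) (is @ [k])
      = f (js @ [k]) * indicator (Delta (Suc m)) (js @ [k])"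
    by (simp add: indicator_def)
qed

text \<open>In order \<open>m\<close> the factor \<open>m\<close> turns \<open>fact (m - 1)\<close>
  into \<open>fact m\<close>, the indicator removes the case \<open>k \<in> B\<close>, and symmetry
  moves the appended \<open>k\<close> to its sorted position. The resulting coefficients depend on
  \<open>F\<close> alone, not on the expansion.\<close>

lemma
  fixes k :: nat
  assumes "chaos_expansion p n f F"
  defines "G \<equiv> \<lambda>\<omega>. \<Sum>m\<le>n. real m * J p (m - 1) (\<lambda>is. f m (is @ [k]) * indicator (Delta m) (is @ [k])) \<omega>"
  shows chaotic_expansion_grad: "chaotic G"
    and chaos_coeff_expansion_grad:
      "finite B \<Longrightarrow> chaos_coeff p G B = (if k \<in> B then 0 else chaos_coeff p F (insert k B))"
proof -
  let ?h = "\<lambda>m is. f m (is @ [k]) * indicator (Delta m) (is @ [k])"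
  let ?G = "\<lambda>m \<omega>. real m * J p (m - 1) (?h m) \<omega>"
  have f: "f m \<in> sym_l2 m" if "m \<le> n" for m
    using assms that by (simp add: chaos_expansion_def)
  have h: "?h (Suc m) \<in> sym_l2 m" if "Suc m \<le> n" for m
    by (rule sym_l2_partial[OF f[OF that]])
  have chaotic: "chaotic (?G m)" if "m \<le> n" for m
  proof (cases m)
    \<comment> \<open>Truncated subtraction makes \<open>m - 1\<close> equal to 0 here, but the
      factor \<open>real m\<close> annihilates the term.\<close>
    case 0
    then show ?thesis by (simp add: chaotic_const)
  next
    case (Suc m')
    then show ?thesis
      using h[of m'] that by (simp add: chaotic_cmult chaotic_J)
  qed
  then show "chaotic G"
    unfolding G_def by (intro chaotic_sum) auto
  assume B: "finite B"
  have coeff: "chaos_coeff p (?G m) B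
      = (if m = Suc (card B) then if k \<in> B then 0 else fact m * f m (sorted_list_of_set (insert k B)) else 0)"
    if "m \<le> n" for m
  proof (cases m)
    case 0
    then show ?thesis by (simp add: chaos_coeff_def)
  next
    case (Suc m')
    then have "chaos_coeff p (?G m) B = real m * chaos_coeff p (J p m' (?h m)) B"
      by (simp only: chaos_coeff_cmult diff_Suc_1)
    also have "chaos_coeff p (J p m' (?h m)) B = (if card B = m' then fact m' * ?h m (sorted_list_of_set B) else 0)"
      using h[of m'] Suc that B by (intro chaos_coeff_J) simp_all
    also have "real m * \<dots> = (if card B = m' then fact m * ?h m (sorted_list_of_set B) else 0)"
      by (simp add: Suc)
    finally have eq: "chaos_coeff p (?G m) B = (if card B = m' then fact m * ?h m (sorted_list_of_set B) else 0)" .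
    have "?h m (sorted_list_of_set B) = (if k \<in> B then 0 else f m (sorted_list_of_set (insert k B)))"
      if "card B = m'"
    proof (cases "k \<in> B")
      case False
      have "f m (sorted_list_of_set B @ [k]) = f m (sorted_list_of_set (insert k B))"
      proof (rule sym_l2D(2)[OF f[OF \<open>m \<le> n\<close>]])
        show "length (sorted_list_of_set B @ [k]) = m"
          using that Suc by simp
        show "mset (sorted_list_of_set B @ [k]) = mset (sorted_list_of_set (insert k B))"
          using B False by simp
      qed
      then show ?thesis
        using False B that Suc by (simp add: Delta_def)
    qed (use B in \<open>simp add: Delta_def\<close>)
    then show ?thesis
      unfolding eq using Suc by auto
  qed
  have "chaos_coeff p G B = (\<Sum>m\<le>n. chaos_coeff p (?G m) B)"
    unfolding G_def using chaotic B by (intro chaos_coeff_sum chaotic_L2) auto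
  also have "\<dots> = (if Suc (card B) \<le> n then if k \<in> B then 0
      else fact (Suc (card B)) * f (Suc (card B)) (sorted_list_of_set (insert k B)) else 0)"
    using coeff by (simp del: fact_Suc)
  also have "\<dots> = (if k \<in> B then 0 else chaos_coeff p F (insert k B))"
    using chaos_expansionD(2)[OF assms(1), of "insert k B"] B by (simp del: fact_Suc)
  finally show "chaos_coeff p G B = (if k \<in> B then 0 else chaos_coeff p F (insert k B))" .
qed

text \<open>Membership in the chaos space provides an expansion, so the representative chosen in
  \<open>grad\<close> comes from one; the coefficient formula holds for whichever it is.\<close>

lemma
  assumes "F \<in> chaos_space p"
  shows chaotic_grad: "chaotic (grad p k F)"
    and chaos_coeff_grad:
      "finite B \<Longrightarrow> chaos_coeff p (grad p k F) B = (if k \<in> B then 0 else chaos_coeff p F (insert k B))"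
proof -
  have "\<exists>G n f. chaos_expansion p n f F \<and>
    G = (\<lambda>\<omega>. \<Sum>m\<le>n. real m * J p (m - 1) (\<lambda>is. f m (is @ [k]) * indicator (Delta m) (is @ [k])) \<omega>)"
    using assms by (auto simp: chaos_space_def)
  from someI_ex[OF this] obtain n f where expansion: "chaos_expansion p n f F" and
    grad: "grad p k F = (\<lambda>\<omega>. \<Sum>m\<le>n. real m * J p (m - 1) (\<lambda>is. f m (is @ [k]) * indicator (Delta m) (is @ [k])) \<omega>)"
    unfolding grad_def by blast
  show "chaotic (grad p k F)"
    unfolding grad by (rule chaotic_expansion_grad[OF expansion])
  show "chaos_coeff p (grad p k F) B = (if k \<in> B then 0 else chaos_coeff p F (insert k B))" if "finite B"
    unfolding grad by (rule chaos_coeff_expansion_grad[OF expansion that])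
qed

section \<open>Conditional expectations of chaos elements\<close>

lemma chaotic_chaos_space: "F \<in> chaos_space p \<Longrightarrow> chaotic F"
  using chaos_expansionD(1) by (auto simp: chaos_space_def)

lemma
  assumes "F \<in> L2_fun M"
  shows chaotic_cond_exp: "chaotic (real_cond_exp M (Filt p (int N - 1)) F)"
    and chaos_coeff_cond_exp: "finite A \<Longrightarrow>
      chaos_coeff p (real_cond_exp M (Filt p (int N - 1)) F) A = (if A \<subseteq> {..<N} then chaos_coeff p F A else 0)"
proof -
  have "chaotic (chaos_sum N F)"
    unfolding chaos_sum_def by (rule chaotic_Yspan[OF _ finite_Pow_lessThan]) simp
  then show "chaotic (real_cond_exp M (Filt p (int N - 1)) F)"
    by (rule chaotic_cong_AE) (simp_all add: cond_exp_Filt[OF assms])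
  show "chaos_coeff p (real_cond_exp M (Filt p (int N - 1)) F) A = (if A \<subseteq> {..<N} then chaos_coeff p F A else 0)"
    if "finite A"
    using chaos_coeff_cong_AE[OF cond_exp_Filt[OF assms]] L2_funD(1)[OF chaos_sum_L2]
      chaos_coeff_chaos_sum[OF that] by simp
qed

text \<open>This makes the gradient of a conditional expectation meaningful. Setting each kernel to
  0 on lists with an entry outside \<open>{..<N}\<close> keeps it symmetric and produces exactly the
  coefficients of the conditional expectation.\<close>

lemma cond_exp_chaos_space:
  assumes "F \<in> chaos_space p"
  shows "real_cond_exp M (Filt p (int N - 1)) F \<in> chaos_space p"
proof -
  let ?H = "real_cond_exp M (Filt p (int N - 1)) F"
  obtain n f where expansion: "chaos_expansion p n f F"
    using assms by (auto simp: chaos_space_def)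
  have F: "F \<in> L2_fun M"
    using assms chaotic_chaos_space chaotic_L2 by blast
  define f' where "f' m is = f m is * indicator {is. set is \<subseteq> {..<N}} is" for m "is"
  have f': "f' m \<in> sym_l2 m" if "m \<le> n" for m
  proof -
    have f: "f m \<in> sym_l2 m"
      using expansion that by (simp add: chaos_expansion_def)
    have "(\<lambda>is. (f' m is)\<^sup>2) summable_on {is. length is = m}"
      by (rule summable_on_comparison_test[OF sym_l2D(1)[OF f]]) (auto simp: f'_def indicator_def)
    moreover have "f' m is = f' m js" if "length is = m" "mset is = mset js" for "is" js
      using sym_l2D(2)[OF f that] mset_eq_setD[OF that(2)] by (simp add: f'_def indicator_def)
    ultimately show ?thesis
      by (auto simp: sym_l2_def)
  qed
  let ?S = "\<lambda>\<omega>. \<Sum>m\<le>n. J p m (f' m) \<omega>"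
  have S: "chaotic ?S"
    using f' by (intro chaotic_sum chaotic_J) auto
  then have expansion': "chaos_expansion p n f' ?S"
    using f' L2_funD(1)[OF chaotic_L2[OF S]] by (simp add: chaos_expansion_def)
  have "AE \<omega> in M. ?H \<omega> = ?S \<omega>"
  proof (rule chaotic_unique[OF chaotic_cond_exp[OF F] S])
    show "chaos_coeff p ?H A = chaos_coeff p ?S A" if "finite A" for A
      using that chaos_coeff_cond_exp[OF F] chaos_expansionD(2)[OF expansion] chaos_expansionD(2)[OF expansion']
      by (simp add: f'_def)
  qed
  then have "chaos_expansion p n f' ?H"
    using f' by (simp add: chaos_expansion_def)
  then show ?thesis
    by (auto simp: chaos_space_def)
qed

subsection \<open>The Clark formula\<close>

text \<open>The sets \<open>insert k B\<close> with \<open>B \<subseteq> {..<k}\<close> are those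
  with maximum \<open>k\<close>; none of these \<open>B\<close> contains \<open>k\<close>, so the
  factor \<open>Y p k\<close> is absorbed into the product.\<close>

lemma Y_mult_Yspan:
  "Y p k \<omega> * Yspan p (\<lambda>B. a (insert k B)) (Pow {..<k}) \<omega>
    = (\<Sum>B\<in>Pow {..<k}. a (insert k B) * Yprod p (insert k B) \<omega>)"
proof -
  have "Yprod p (insert k B) \<omega> = Y p k \<omega> * Yprod p B \<omega>" if "B \<in> Pow {..<k}" for B
    using that finite_Pow_lessThan[OF that] by (intro Yprod_insert) auto
  then show ?thesis
    by (simp add: Yspan_def sum_distrib_left mult.left_commute)
qed

text \<open>The \<open>k\<close>-th term is \<open>chaos_sum (Suc k) F - chaos_sum k F\<close>, and
  \<open>chaos_sum 0 F\<close> consists of the coefficient at the empty set, which is the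
  expectation.\<close>

lemma chaos_sum_telescope:
  "(\<Sum>k<N. Y p k \<omega> * Yspan p (\<lambda>B. chaos_coeff p F (insert k B)) (Pow {..<k}) \<omega>)
    = chaos_sum N F \<omega> - integral\<^sup>L M F"
proof (induction N)
  case 0
  show ?case
    by (simp add: chaos_sum_def Yspan_def chaos_coeff_def)
next
  case (Suc N)
  then show ?case
    unfolding chaos_sum_def Y_mult_Yspan by (simp add: Yspan_def sum_Pow_lessThan_Suc)
qed

text \<open>A common criterion for both series: it suffices to identify each term almost everywhere,
  since the partial sums then telescope and \<open>chaotic F\<close> is the required
  convergence.\<close>

lemma L2_sums_chaos:
  assumes F: "chaotic F" and g [measurable]: "\<And>k. g k \<in> borel_measurable M"
    and eq: "\<And>k. AE \<omega> in M. g k \<omega> = Y p k \<omega> * Yspan p (\<lambda>B. chaos_coeff p F (insert k B)) (Pow {..<k}) \<omega>"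
  shows "L2_sums M g (\<lambda>\<omega>. F \<omega> - integral\<^sup>L M F)"
  unfolding L2_sums_def
proof (intro conjI allI)
  note [measurable] = L2_funD(1)[OF chaotic_L2[OF F]] L2_funD(1)[OF chaos_sum_L2]
  show "g k \<in> L2_fun M" for k
  proof (rule L2_fun_cong_AE[OF _ g])
    have "(\<lambda>\<omega>. \<Sum>B\<in>Pow {..<k}. chaos_coeff p F (insert k B) * Yprod p (insert k B) \<omega>) \<in> L2_fun M"
      by (intro L2_fun_sum L2_fun_cmult Yprod_L2 finite.insertI finite_Pow_lessThan)
    then show "(\<lambda>\<omega>. Y p k \<omega> * Yspan p (\<lambda>B. chaos_coeff p F (insert k B)) (Pow {..<k}) \<omega>) \<in> L2_fun M"
      unfolding Y_mult_Yspan .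
  qed (rule eq)
  show "(\<lambda>\<omega>. F \<omega> - integral\<^sup>L M F) \<in> L2_fun M"
    by (intro L2_fun_diff chaotic_L2 F chaotic_const)
  have "(\<integral>\<omega>. ((\<Sum>k<N. g k \<omega>) - (F \<omega> - integral\<^sup>L M F))\<^sup>2 \<partial>M) = (\<integral>\<omega>. (F \<omega> - chaos_sum N F \<omega>)\<^sup>2 \<partial>M)" for N
  proof (rule integral_cong_AE)
    \<comment> \<open>One null set serves for all of the countably many terms.\<close>
    have "AE \<omega> in M. \<forall>k. g k \<omega> = Y p k \<omega> * Yspan p (\<lambda>B. chaos_coeff p F (insert k B)) (Pow {..<k}) \<omega>"
      using eq by (simp add: AE_all_countable)
    then show "AE \<omega> in M. ((\<Sum>k<N. g k \<omega>) - (F \<omega> - integral\<^sup>L M F))\<^sup>2 = (F \<omega> - chaos_sum N F \<omega>)\<^sup>2"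
      by eventually_elim (simp add: chaos_sum_telescope power2_commute)
  qed measurable
  then show "(\<lambda>N. L2_norm M (\<lambda>\<omega>. (\<Sum>k<N. g k \<omega>) - (F \<omega> - integral\<^sup>L M F))) \<longlonglongrightarrow> 0"
    using F tendsto_real_sqrt[of _ 0 sequentially] by (simp add: L2_norm_def chaotic_def)
qed

text \<open>Conditioning the gradient on the coordinates before \<open>k\<close>, or differentiating
  after conditioning on those up to \<open>k\<close>, leaves the same coefficients:
  \<open>chaos_coeff p F (insert k B)\<close> for \<open>B \<subseteq> {..<k}\<close>.\<close>

lemma Clark_formula:
  assumes F: "F \<in> chaos_space p"
  shows "L2_sums M (\<lambda>k \<omega>. real_cond_exp M (Filt p (int k - 1)) (grad p k F) \<omega> * Y p k \<omega>)
      (\<lambda>\<omega>. F \<omega> - integral\<^sup>L M F)" (is ?A)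
    and "L2_sums M (\<lambda>k \<omega>. Y p k \<omega> * grad p k (real_cond_exp M (Filt p (int k)) F) \<omega>)
      (\<lambda>\<omega>. F \<omega> - integral\<^sup>L M F)" (is ?B)
proof -
  have chaotic: "chaotic F"
    by (rule chaotic_chaos_space[OF F])
  let ?T = "\<lambda>k. Yspan p (\<lambda>B. chaos_coeff p F (insert k B)) (Pow {..<k})"
  show ?A
  proof (rule L2_sums_chaos[OF chaotic])
    fix k
    have "chaos_sum k (grad p k F) = ?T k"
      unfolding chaos_sum_def Yspan_def[abs_def]
      by (intro ext sum.cong refl) (auto simp: chaos_coeff_grad[OF F] finite_subset)
    with cond_exp_Filt[OF chaotic_L2[OF chaotic_grad[OF F]], of k k]
    show "AE \<omega> in M. real_cond_exp M (Filt p (int k - 1)) (grad p k F) \<omega> * Y p k \<omega> = Y p k \<omega> * ?T k \<omega>"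
      by (auto simp: mult.commute)
  qed measurable
  show ?B
  proof (rule L2_sums_chaos[OF chaotic])
    fix k
    \<comment> \<open>The index equals \<open>int k\<close>, written in the form in which the
      results on conditional expectations are stated.\<close>
    let ?H = "real_cond_exp M (Filt p (int (Suc k) - 1)) F"
    have H: "?H \<in> chaos_space p"
      by (rule cond_exp_chaos_space[OF F])
    show "(\<lambda>\<omega>. Y p k \<omega> * grad p k (real_cond_exp M (Filt p (int k)) F) \<omega>) \<in> borel_measurable M"
      using chaotic_grad[OF H, THEN chaotic_L2, THEN L2_funD(1), of k] by simp
    have "AE \<omega> in M. grad p k ?H \<omega> = ?T k \<omega>"
    proof (rule chaotic_unique[OF chaotic_grad[OF H]])
      show "chaotic (?T k)"
        by (rule chaotic_Yspan[OF _ finite_Pow_lessThan]) simp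
      fix B :: "nat set" assume B: "finite B"
      have "chaos_coeff p (grad p k ?H) B
          = (if k \<in> B then 0 else if insert k B \<subseteq> {..<Suc k} then chaos_coeff p F (insert k B) else 0)"
        using chaos_coeff_grad[OF H B] chaos_coeff_cond_exp[OF chaotic_L2[OF chaotic], of "insert k B" "Suc k"] B
        by simp
      \<comment> \<open>For \<open>k \<notin> B\<close>, the set \<open>insert k B\<close> lies in
        \<open>{..<Suc k}\<close> exactly when \<open>B\<close> lies in
        \<open>{..<k}\<close>.\<close>
      also have "\<dots> = (if B \<in> Pow {..<k} then chaos_coeff p F (insert k B) else 0)"
        by (auto simp: less_Suc_eq)
      also have "\<dots> = chaos_coeff p (?T k) B"
        using chaos_coeff_Yspan[OF _ finite_Pow_lessThan B, of "Pow {..<k}"] by simp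
      finally show "chaos_coeff p (grad p k ?H) B = chaos_coeff p (?T k) B" .
    qed
    then show "AE \<omega> in M. Y p k \<omega> * grad p k (real_cond_exp M (Filt p (int k)) F) \<omega> = Y p k \<omega> * ?T k \<omega>"
      by auto
  qed
qed

end

theorem proposition8p1:
  fixes p :: "nat \<Rightarrow> real" and F :: "(nat \<Rightarrow> real) \<Rightarrow> real"
  assumes "\<And>k. 0 < p k \<and> p k < 1"
    and "F \<in> chaos_space p"
  shows "L2_sums (walk_measure p)
           (\<lambda>k \<omega>. real_cond_exp (walk_measure p) (Filt p (int k - 1)) (grad p k F) \<omega> * Y p k \<omega>)
           (\<lambda>\<omega>. F \<omega> - integral\<^sup>L (walk_measure p) F)
       \<and> L2_sums (walk_measure p)
           (\<lambda>k \<omega>. Y p k \<omega> * grad p k (real_cond_exp (walk_measure p) (Filt p (int k)) F) \<omega>)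
           (\<lambda>\<omega>. F \<omega> - integral\<^sup>L (walk_measure p) F)"
proof -
  interpret bernoulli_walk p
    using assms(1) by unfold_locales auto
  show ?thesis
    using Clark_formula[OF assms(2)] by blast
qed

end
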